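(* Let $$v^{(2)}=\Theta^0_0+\beta^1_1E^1_1+\beta^0_1E^0_1+\beta^2_2E^2_2+\beta^1_2E^1_2+\sum_{k=2}^\infty\beta^0_kE^0_k,\qquad \beta^1_1\ne0.$$ There exist a natural number $r$ and a formal near-identity transformation sending $v^{(2)}$ into one of the following $(2r+2)$-th level extended partial normal forms (the $\beta^l_k\in\mathbb{F}$ denoting updated coefficients): either $$v^{(2r+2)}=\Theta^0_0+\beta^1_1E^1_1+\beta^0_1E^0_1+\beta^2_2E^2_2+\beta^1_2E^1_2+\beta^0_rE^0_r+\sum_{k=r+2}^\infty\beta^0_kE^0_k\quad(r\ge2),$$ or $$v^{(2r+2)}=\Theta^0_0+\beta^1_1E^1_1+\beta^0_1E^0_1+\beta^2_2E^2_2+\beta^1_2E^1_2+\beta^0_1(\beta^1_2-\beta^0_1\beta^2_2)E^0_2+\beta^0_rE^0_r+\sum_{k=r+2}^\infty\beta^0_kE^0_k,$$ where in the second case $\beta^0_1(\beta^1_2-\beta^0_1\beta^2_2)\ne0$ and $r>2$. Furthermore, $v^{(2r+2)}=v^{(\infty)}$, i.e. this vector field is in infinite level normal form, and for $\beta^0_r\ne0$ there is no non-trivial symmetry in the symmetry group of $v^{(\infty)}$.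
   Context: $\mathbb{F}$ is a field of characteristic zero. Let $E:=x\frac{\partial}{\partial x}+\frac12 y\frac{\partial}{\partial y}+\frac12 z\frac{\partial}{\partial z}$, $E^l_k:=x^l(y^2+z^2)^{k-l}E$ for $0\le l\le k$, and $\Theta^0_0:=z\frac{\partial}{\partial y}-y\frac{\partial}{\partial z}$. Let $\mathscr{E}$ be the Lie algebra of all formal sums $\sum\beta^l_kE^l_k$ ($\beta^l_k\in\mathbb{F}$, $k\ge l\ge0$, $l+k\ge1$). One has $[E^l_k,E^m_n]=(n-k)E^{l+m}_{k+n}$ and $[E^l_k,\Theta^0_0]=0$. Grading: $\delta(E^l_k):=2k-l$, $\delta(\Theta^0_0):=0$. $\mathscr{E}_n$ denotes the span of the $E^l_k\in\mathscr{E}$ of grade $n$, and $v_n$ denotes the grade-$n$ part of $v$ (so $v_0=\Theta^0_0$). Permissible transformations: the formal near-identity changes of state variables generated by $A:=\sum_{i\ge1}A_i$, $A_i:=\mathscr{E}_i$. An element $S\in A$ acts on vector fields by $v\mapsto\exp(\mathrm{ad}_S)v$. Its initially linear action is $S*v:=[S,v]$. Levels of normal form: for $v=\sum_{i\ge0}v_i$, define inductively $d^{n,1}(Y_n):=Y_n*v_0$ for $Y_n\in A_n$, and for $2\le k\le n$ $$d^{n,k}:A_n\times\ker(d^{n-1,k-1})\to\mathscr{E}_n,\quad d^{n,k}(Y_n,Y_{n-1},\ldots,Y_{n-k+1}):=\sum_{i=0}^{k-1}Y_{n-i}*v_i,$$ where $(Y_{n-1},\ldots,Y_{n-k+1})\in\ker(d^{n-1,k-1})$.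 For $k>n$, $d^{n,k}:=d^{n,n}$. A normal form style fixes a complement $\mathcal{C}^{n,k}$ of $\operatorname{im}d^{n,k}$ in $\mathscr{E}_n$. The vector field $v$ is in $k$-th level extended partial normal form if $v_n\in\mathcal{C}^{n,k}$ for every $n\in\mathbb{N}$, for such a choice of complements. It is in infinite level normal form (denoted $v^{(\infty)}$, the "simplest normal form") if $v_n\in\mathcal{C}^{n,n}$ for every $n\in\mathbb{N}$. Symmetry group: the subgroup of permissible transformations leaving $v^{(\infty)}$ invariant. It is generated by $B:=\{S\in A: S*v^{(\infty)}=0\}$. A symmetry is trivial if it is generated by a scalar multiple of $v^{(\infty)}-\Theta^0_0\in\mathscr{E}$, which always commutes with $v^{(\infty)}$; otherwise it is non-trivial.
   Formalization: The coefficient β^0_1(β^1_2−β^0_1β^2_2) of E^0_2 in the second form, and its non-vanishing condition, is corrected to β^0_1(β^1_1β^1_2−β^0_1β^2_2)/(β^1_1)^2; the two agree for β^1_1=1, and the printed formula fails for general β^1_1≠0. *)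

theory Defs
  imports
    "HOL-Analysis.Cartesian_Space"
    "HOL-Computational_Algebra.Formal_Power_Series"
begin

section \<open>Formal vector fields in three variables\<close>

text \<open>Power series in \<open>x\<close>, \<open>y\<close>, \<open>z\<close> are iterated univariate series: \<open>z\<close> is the outermost
  variable and \<open>x\<close> the innermost one.\<close>

type_synonym 'a fps3 = "'a fps fps fps"

text \<open>The components of a vector field are its coefficients at
  \<open>\<partial>/\<partial>x\<close>, \<open>\<partial>/\<partial>y\<close>, \<open>\<partial>/\<partial>z\<close>.\<close>

type_synonym 'a vfield = "('a fps3) ^ 3"

definition const3 :: "'a::zero \<Rightarrow> 'a fps3" where
  "const3 c = fps_const (fps_const (fps_const c))"

definition var_x :: "'a::{zero,one} fps3" where
  "var_x = fps_const (fps_const fps_X)"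

definition var_y :: "'a::{zero,one} fps3" where
  "var_y = fps_const fps_X"

definition var_z :: "'a::{zero,one} fps3" where
  "var_z = fps_X"

definition coeff3 :: "'a fps3 \<Rightarrow> nat \<Rightarrow> nat \<Rightarrow> nat \<Rightarrow> 'a" where
  "coeff3 f a b c = fps_nth (fps_nth (fps_nth f c) b) a"

definition diff_x :: "'a::comm_ring_1 fps3 \<Rightarrow> 'a fps3" where
  "diff_x f = Abs_fps (\<lambda>c. Abs_fps (\<lambda>b. fps_deriv (fps_nth (fps_nth f c) b)))"

definition diff_y :: "'a::comm_ring_1 fps3 \<Rightarrow> 'a fps3" where
  "diff_y f = Abs_fps (\<lambda>c. fps_deriv (fps_nth f c))"

definition diff_z :: "'a::comm_ring_1 fps3 \<Rightarrow> 'a fps3" where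
  "diff_z f = fps_deriv f"

definition vf_apply :: "'a::comm_ring_1 vfield \<Rightarrow> 'a fps3 \<Rightarrow> 'a fps3" where
  "vf_apply V f = V $ 1 * diff_x f + V $ 2 * diff_y f + V $ 3 * diff_z f"

definition lie :: "'a::comm_ring_1 vfield \<Rightarrow> 'a vfield \<Rightarrow> 'a vfield" where
  "lie V W = (\<chi> i. vf_apply V (W $ i) - vf_apply W (V $ i))"

definition smul :: "'a::comm_ring_1 \<Rightarrow> 'a vfield \<Rightarrow> 'a vfield" where
  "smul c V = const3 c *s V"

global_interpretation vf: vector_space "smul :: 'a::field \<Rightarrow> 'a vfield \<Rightarrow> 'a vfield"
  defines vf_span = vf.span
    and vf_subspace = vf.subspace
  by standard
    (simp_all add: smul_def const3_def vector_add_ldistrib vector_sadd_rdistrib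
      vector_smult_assoc flip: fps_const_add fps_const_mult)

text \<open>The sum of a (possibly infinite) family of vector fields, computed coefficient by
  coefficient. It is meaningful for locally finite families, i.e. those for which every
  monomial occurs in only finitely many members (otherwise the inner sum is the dummy value
  \<open>0\<close>); all families below to which it is applied are of this kind.\<close>

definition formal_sum :: "('i \<Rightarrow> 'a::comm_ring_1 vfield) \<Rightarrow> 'i set \<Rightarrow> 'a vfield" where
  "formal_sum F I = (\<chi> j. Abs_fps (\<lambda>c. Abs_fps (\<lambda>b. Abs_fps (\<lambda>a.
     \<Sum>i | i \<in> I \<and> coeff3 (F i $ j) a b c \<noteq> 0. coeff3 (F i $ j) a b c))))"


section \<open>The Lie algebra and its grading\<close>

definition E0 :: "'a::field_char_0 vfield" where
  "E0 = vector [var_x, const3 (1/2) * var_y, const3 (1/2) * var_z]"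

definition E :: "nat \<Rightarrow> nat \<Rightarrow> 'a::field_char_0 vfield" where
  "E l k = (var_x ^ l * (var_y\<^sup>2 + var_z\<^sup>2) ^ (k - l)) *s E0"

definition Theta :: "'a::field_char_0 vfield" where
  "Theta = vector [0, var_z, - var_y]"

definition E_indices :: "(nat \<times> nat) set" where
  "E_indices = {(l, k). l \<le> k \<and> 1 \<le> l + k}"

definition E_grade :: "nat \<Rightarrow> nat \<Rightarrow> nat" where
  "E_grade l k = 2 * k - l"

definition E_space :: "nat \<Rightarrow> 'a::field_char_0 vfield set" where
  "E_space n = vf_span {E l k | l k. (l, k) \<in> E_indices \<and> E_grade l k = n}"

text \<open>\<open>is_decomp v u\<close>: \<open>v\<close> is the formal sum of the homogeneous terms \<open>u i\<close> of grade \<open>i\<close>, in the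
  Lie algebra spanned by \<open>\<Theta>\<^sup>0\<^sub>0\<close> (of grade \<open>0\<close>) and the \<open>E l k\<close> (no \<open>E l k\<close> has grade \<open>0\<close>). The
  terms are unique because \<open>\<Theta>\<^sup>0\<^sub>0\<close> and the \<open>E l k\<close> are linearly independent.\<close>

definition is_decomp :: "'a::field_char_0 vfield \<Rightarrow> (nat \<Rightarrow> 'a vfield) \<Rightarrow> bool" where
  "is_decomp v u \<longleftrightarrow>
     u 0 \<in> vf_span {Theta} \<and> (\<forall>i\<ge>1. u i \<in> E_space i) \<and> v = formal_sum u UNIV"

definition grade_part :: "'a::field_char_0 vfield \<Rightarrow> nat \<Rightarrow> 'a vfield" where
  "grade_part v = (THE u. is_decomp v u)"


section \<open>Permissible transformations and symmetries\<close>

text \<open>The generators \<open>A = \<Sum>\<^sub>i\<^sub>\<ge>\<^sub>1 A\<^sub>i\<close> with \<open>A\<^sub>i\<close> the \<open>i\<close>-th graded piece.\<close>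

definition generators :: "'a::field_char_0 vfield set" where
  "generators = {formal_sum Y {1..} | Y. \<forall>i\<ge>1. Y i \<in> E_space i}"

definition exp_ad :: "'a::field_char_0 vfield \<Rightarrow> 'a vfield \<Rightarrow> 'a vfield" where
  "exp_ad S v = formal_sum (\<lambda>m. smul (1 / fact m) ((lie S ^^ m) v)) UNIV"

text \<open>By the Baker-Campbell-Hausdorff formula these exponentials already form a group.\<close>

definition permissible :: "('a::field_char_0 vfield \<Rightarrow> 'a vfield) set" where
  "permissible = exp_ad ` generators"

definition symmetry_group ::
    "'a::field_char_0 vfield \<Rightarrow> ('a vfield \<Rightarrow> 'a vfield) set" where
  "symmetry_group v = {\<phi> \<in> permissible. \<phi> v = v}"

definition trivial_symmetry ::
    "'a::field_char_0 vfield \<Rightarrow> ('a vfield \<Rightarrow> 'a vfield) \<Rightarrow> bool" where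
  "trivial_symmetry v \<phi> \<longleftrightarrow> (\<exists>c. \<phi> = exp_ad (smul c (v - Theta)))"


section \<open>Levels of normal form\<close>

text \<open>A tuple \<open>(Y\<^sub>n, \<dots>, Y\<^sub>n\<^sub>-\<^sub>k\<^sub>+\<^sub>1)\<close> is encoded as a function \<open>Y\<close> on grades; its values outside
  \<open>{n-k+1..n}\<close> are irrelevant. The maps are only used for \<open>1 \<le> k \<le> n\<close>.\<close>

definition level_map ::
    "'a::field_char_0 vfield \<Rightarrow> nat \<Rightarrow> nat \<Rightarrow> (nat \<Rightarrow> 'a vfield) \<Rightarrow> 'a vfield" where
  "level_map v n k Y = (\<Sum>i<k. lie (Y (n - i)) (grade_part v i))"

text \<open>The domain of the \<open>(n, k)\<close>-th map, \<open>A\<^sub>n \<times> ker d\<^sup>n\<^sup>-\<^sup>1\<^sup>,\<^sup>k\<^sup>-\<^sup>1\<close>. For \<open>k = 1\<close> it is \<open>A\<^sub>n\<close>, since the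
  map with \<open>k = 0\<close> is an empty sum and imposes no condition.\<close>

fun level_dom ::
    "'a::field_char_0 vfield \<Rightarrow> nat \<Rightarrow> nat \<Rightarrow> (nat \<Rightarrow> 'a vfield) set" where
  "level_dom v n 0 = UNIV"
| "level_dom v n (Suc k) =
     {Y. Y n \<in> E_space n \<and> Y \<in> level_dom v (n - 1) k \<and> level_map v (n - 1) k Y = 0}"

definition level_im :: "'a::field_char_0 vfield \<Rightarrow> nat \<Rightarrow> nat \<Rightarrow> 'a vfield set" where
  "level_im v n k = level_map v n k ` level_dom v n k"

definition is_complement ::
    "'a::field_char_0 vfield set \<Rightarrow> 'a vfield set \<Rightarrow> 'a vfield set \<Rightarrow> bool" where
  "is_complement C W U \<longleftrightarrow>
     vf_subspace C \<and> C \<subseteq> U \<and> C \<inter> W = {0} \<and> U = {c + w | c w. c \<in> C \<and> w \<in> W}"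

definition normal_form_style ::
    "'a::field_char_0 vfield \<Rightarrow> (nat \<Rightarrow> nat \<Rightarrow> 'a vfield set) \<Rightarrow> bool" where
  "normal_form_style v C \<longleftrightarrow>
     (\<forall>n k. 1 \<le> k \<and> k \<le> n \<longrightarrow> is_complement (C n k) (level_im v n k) (E_space n))"

text \<open>The minimum reflects the convention \<open>d\<^sup>n\<^sup>,\<^sup>k = d\<^sup>n\<^sup>,\<^sup>n\<close> for \<open>k > n\<close>.\<close>

definition level_normal_form ::
    "(nat \<Rightarrow> nat \<Rightarrow> 'a::field_char_0 vfield set) \<Rightarrow> nat \<Rightarrow> 'a vfield \<Rightarrow> bool" where
  "level_normal_form C k v \<longleftrightarrow>
     normal_form_style v C \<and> (\<forall>n\<ge>1. grade_part v n \<in> C n (min k n))"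

definition infinite_normal_form ::
    "(nat \<Rightarrow> nat \<Rightarrow> 'a::field_char_0 vfield set) \<Rightarrow> 'a vfield \<Rightarrow> bool" where
  "infinite_normal_form C v \<longleftrightarrow>
     normal_form_style v C \<and> (\<forall>n\<ge>1. grade_part v n \<in> C n n)"


text \<open>Let \<open>\<gamma> 1 1 \<noteq> 0\<close> and \<open>\<rho> = y\<^sup>2 + z\<^sup>2\<close>. This is the only value of \<open>\<gamma> 0 2\<close> for which the form
  \<open>\<gamma> 1 1 * x + \<gamma> 0 1 * \<rho>\<close> divides \<open>\<gamma> 2 2 * x\<^sup>2 + \<gamma> 1 2 * x * \<rho> + \<gamma> 0 2 * \<rho>\<^sup>2\<close>; for this value, and only
  for it, the term in \<open>E 0 3\<close> is not removable. As the coefficients of all \<open>E l k\<close> with \<open>k \<le> 2\<close> are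
  invariant under near-identity transformations, \<open>\<gamma> 1 1\<close> cannot be scaled to \<open>1\<close>; the
  simpler expression \<open>\<gamma> 0 1 * (\<gamma> 1 2 - \<gamma> 0 1 * \<gamma> 2 2)\<close> is the value for \<open>\<gamma> 1 1 = 1\<close>.\<close>

definition divisible_coeff :: "(nat \<Rightarrow> nat \<Rightarrow> 'a::field_char_0) \<Rightarrow> 'a" where
  "divisible_coeff \<gamma> = \<gamma> 0 1 * (\<gamma> 1 1 * \<gamma> 1 2 - \<gamma> 0 1 * \<gamma> 2 2) / (\<gamma> 1 1)\<^sup>2"

lemma divisible_coeff_normalised:
  "\<gamma> 1 1 = 1 \<Longrightarrow> divisible_coeff \<gamma> = \<gamma> 0 1 * (\<gamma> 1 2 - \<gamma> 0 1 * \<gamma> 2 2)"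
  by (simp add: divisible_coeff_def)


section \<open>The structure constants\<close>

lemma diff_x_mult: "diff_x (f * g) = diff_x f * g + f * diff_x g"
  by (simp add: diff_x_def fps_eq_iff[where 'a="'a fps fps"] fps_eq_iff[where 'a="'a fps"]
      fps_mult_nth[where 'a="'a fps fps"] fps_mult_nth[where 'a="'a fps"]
      fps_sum_nth fps_deriv_sum sum.distrib)

lemma diff_y_mult: "diff_y (f * g) = diff_y f * g + f * diff_y g"
  by (simp add: diff_y_def fps_eq_iff[where 'a="'a fps fps"]
      fps_mult_nth[where 'a="'a fps fps"] fps_deriv_sum sum.distrib add.commute)

lemma diff_z_mult: "diff_z (f * g) = diff_z f * g + f * diff_z g"
  by (simp add: diff_z_def)

lemma vf_apply_mult: "vf_apply V (f * g) = vf_apply V f * g + f * vf_apply V g"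
  by (simp add: vf_apply_def diff_x_mult diff_y_mult diff_z_mult algebra_simps)

lemma vf_apply_smult: "vf_apply (f *s V) g = f * vf_apply V g"
  by (simp add: vf_apply_def algebra_simps)

lemma diff_x_simps [simp]:
  "diff_x (f + g) = diff_x f + diff_x g" "diff_x (- f) = - diff_x f" "diff_x 0 = 0"
  "diff_x 1 = 0" "diff_x (const3 c) = 0" "diff_x var_x = 1" "diff_x var_y = 0" "diff_x var_z = 0"
  by (auto simp: diff_x_def fps_eq_iff const3_def var_x_def var_y_def var_z_def fps_X_def)

lemma diff_y_simps [simp]:
  "diff_y (f + g) = diff_y f + diff_y g" "diff_y (- f) = - diff_y f" "diff_y 0 = 0"
  "diff_y 1 = 0" "diff_y (const3 c) = 0" "diff_y var_x = 0" "diff_y var_y = 1" "diff_y var_z = 0"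
  by (auto simp: diff_y_def fps_eq_iff const3_def var_x_def var_y_def var_z_def fps_X_def)

lemma diff_z_simps [simp]:
  "diff_z (f + g) = diff_z f + diff_z g" "diff_z (- f) = - diff_z f" "diff_z 0 = 0"
  "diff_z 1 = 0" "diff_z (const3 c) = 0" "diff_z var_x = 0" "diff_z var_y = 0" "diff_z var_z = 1"
  by (auto simp: diff_z_def const3_def var_x_def var_y_def var_z_def)

lemma const3_half: "const3 (1/2 :: 'a::field_char_0) + const3 (1/2) = 1"
proof -
  have "const3 (1/2 :: 'a) + const3 (1/2) = const3 (1/2 + 1/2)"
    by (simp only: const3_def fps_const_add)
  then show ?thesis
    by (simp add: const3_def)
qed

lemma vf_apply_E0:
  "vf_apply E0 (var_x ^ l * (var_y\<^sup>2 + var_z\<^sup>2) ^ m :: 'a::field_char_0 fps3) =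
     of_nat (l + m) * (var_x ^ l * (var_y\<^sup>2 + var_z\<^sup>2) ^ m)"
proof -
  have 1: "vf_apply E0 1 = (0 :: 'a fps3)"
    by (simp add: vf_apply_def)
  have x: "vf_apply E0 (var_x :: 'a fps3) = var_x"
    by (simp add: vf_apply_def E0_def)
  have "vf_apply E0 (var_y\<^sup>2 + var_z\<^sup>2 :: 'a fps3) =
      (const3 (1/2) + const3 (1/2)) * (var_y\<^sup>2 + var_z\<^sup>2)"
    by (simp add: vf_apply_def E0_def power2_eq_square diff_x_mult diff_y_mult diff_z_mult
        algebra_simps)
  then have r: "vf_apply E0 (var_y\<^sup>2 + var_z\<^sup>2 :: 'a fps3) = var_y\<^sup>2 + var_z\<^sup>2"
    by (simp only: const3_half mult_1_left)
  have pow: "vf_apply E0 (g ^ m) = of_nat m * g ^ m"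
    if "vf_apply E0 g = g" for g :: "'a fps3" and m
    by (induction m) (simp_all add: 1 that vf_apply_mult algebra_simps)
  show ?thesis
    by (simp add: vf_apply_mult pow x r algebra_simps)
qed

lemma lie_smult_same:
  "lie (f *s V) (g *s V) = (f * vf_apply V g - g * vf_apply V f) *s V"
  by (simp add: lie_def vec_eq_iff vf_apply_smult vf_apply_mult algebra_simps)

lemma lie_E_E:
  assumes "l \<le> k" "m \<le> n"
  shows "lie (E l k) (E m n) = smul (of_nat n - of_nat k) (E (l + m) (k + n))"
proof -
  have const3_of_nat: "const3 (of_nat n - of_nat k :: 'a) = of_nat n - of_nat k"
    by (simp add: const3_def fps_of_nat flip: fps_const_sub)
  have "k + n - (l + m) = (k - l) + (n - m)"
    using assms by simp
  then have "(var_y\<^sup>2 + var_z\<^sup>2 :: 'a fps3) ^ (k + n - (l + m)) =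
      (var_y\<^sup>2 + var_z\<^sup>2) ^ (k - l) * (var_y\<^sup>2 + var_z\<^sup>2) ^ (n - m)"
    by (simp add: power_add)
  then show ?thesis
    using assms
    by (simp add: E_def lie_smult_same vf_apply_E0 smul_def vector_smult_assoc const3_of_nat
        power_add algebra_simps)
qed

lemma lie_E_Theta: "lie (E l k) Theta = 0"
proof -
  have 1: "vf_apply Theta 1 = (0 :: 'a fps3)"
    and x: "vf_apply Theta (var_x :: 'a fps3) = 0"
    and r: "vf_apply Theta (var_y\<^sup>2 + var_z\<^sup>2 :: 'a fps3) = 0"
    by (simp_all add: vf_apply_def Theta_def power2_eq_square diff_x_mult diff_y_mult diff_z_mult
        algebra_simps)
  have pow: "vf_apply Theta (g ^ m) = 0" if "vf_apply Theta g = 0" for g :: "'a fps3" and m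
    by (induction m) (simp_all add: 1 that vf_apply_mult)
  have f: "vf_apply Theta (var_x ^ l * (var_y\<^sup>2 + var_z\<^sup>2) ^ (k - l) :: 'a fps3) = 0"
    by (simp add: vf_apply_mult pow[OF x] pow[OF r])
  have E0: "vf_apply E0 (Theta $ i) = vf_apply Theta (E0 $ i :: 'a fps3)" for i
    using exhaust_3[of i]
    by (auto simp: vf_apply_def Theta_def E0_def diff_x_mult diff_y_mult diff_z_mult)
  show ?thesis
    by (simp add: lie_def E_def vec_eq_iff vf_apply_smult f E0
        vf_apply_mult[of Theta "var_x ^ l * (var_y\<^sup>2 + var_z\<^sup>2) ^ (k - l)"])
qed

end

theory Submission
  imports Defs "HOL-Computational_Algebra.Polynomial"
begin

text \<open>
  Put \<open>\<rho> = y\<^sup>2 + z\<^sup>2\<close>. The field \<open>E l k\<close> is \<open>x\<^sup>l \<rho>\<^sup>k\<^sup>-\<^sup>l\<close> times \<open>E 0 0\<close>, and \<open>E 0 0\<close> multiplies a homogeneous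
  polynomial of degree \<open>k\<close> in \<open>x\<close> and \<open>\<rho>\<close> by \<open>k\<close>. So the Lie algebra consists of the power series
  in \<open>x\<close> and \<open>\<rho>\<close> without constant term, with the bracket \<open>f \<cdot> D g - g \<cdot> D f\<close>, where \<open>D\<close> is the Euler
  derivation; \<open>\<Theta>\<^sup>0\<^sub>0\<close> commutes with all of it (\<open>lie_field_of\<close>, \<open>exp_ad_field_of\<close>). The proof is
  organised by the degree \<open>k\<close>, not by the grade \<open>2 k - l\<close>.

  Let \<open>L = \<beta> 1 1 x + \<beta> 0 1 \<rho>\<close> be the part of degree one. A generator \<open>s\<^sub>n\<close> of degree \<open>n\<close> gives
  \<open>[s\<^sub>n, L] = (1 - n) s\<^sub>n L\<close>. Hence the degrees one and two are invariant, and from degree three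
  on exactly the multiples of \<open>L\<close> can be removed by the generator of the preceding degree, which
  leaves a multiple of a power of \<open>\<rho>\<close>. What happens modulo \<open>L\<close> is decided on the line \<open>L = 0\<close>:
  since \<open>D\<close> preserves the ideal of \<open>L\<close>, restriction to this line is a homomorphism to the
  analogous Lie algebra in the one variable \<open>\<rho>\<close> (\<open>on_line_bracket\<close>). Let \<open>r\<close> be the order of the
  restricted vector field; it is an invariant, and \<open>r \<ge> 2\<close> because \<open>L\<close> restricts to zero. As
  \<open>[\<sigma> \<rho>, \<gamma> \<rho>\<^sup>r] = (r - 1) \<sigma> \<gamma> \<rho>\<^sup>r\<^sup>+\<^sup>1\<close>, the remaining freedom in the generator of degree one removes the
  term \<open>\<rho>\<^sup>r\<^sup>+\<^sup>1\<close>, and this is the gap in the normal form. The generator is built in one go: its part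
  of degree one is read off from the restriction, and the others follow by successive
  divisions by \<open>L\<close>, because \<open>s\<^sub>n\<close> enters the degree \<open>n + 1\<close> of \<open>exp (ad s) v\<close> linearly and does
  not enter lower degrees (\<open>normal_form_exists\<close>). Thus a single exponential reaches
  the normal form. If \<open>r = 2\<close>, the coefficient of \<open>E 0 2\<close>
  is arbitrary; if \<open>r > 2\<close>, then \<open>L\<close> divides the part of degree two, which forces that
  coefficient to be \<open>divisible_coeff\<close>. If the restriction vanishes, all powers of \<open>\<rho>\<close> from the
  third on disappear, and \<open>r = 3\<close> serves.

  Nothing else can be removed. The part of lowest degree of a bracket \<open>[f, v]\<close> is \<open>(1 - n) f\<^sub>n L\<close>,
  which restricts to zero, unless \<open>f\<close> begins in degree one; and if \<open>f\<^sub>1\<close> is a multiple of \<open>L\<close>,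
  then a multiple of \<open>v\<close> can be subtracted from \<open>f\<close> without changing the bracket. If \<open>f\<^sub>1\<close> is not
  a multiple of \<open>L\<close>, then the restriction of the bracket begins with \<open>\<rho>\<^sup>r\<^sup>+\<^sup>1\<close>. So \<open>\<rho>\<^sup>r\<^sup>+\<^sup>1\<close> is the only
  power of \<open>\<rho>\<close> that can be the leading part of a bracket (\<open>bracket_pure_leading\<close>). This transfers from
  degrees to grades, because every other monomial of degree at most \<open>k\<close> has a smaller grade than
  \<open>\<rho>\<^sup>k\<close>; and the terms of the normal form that are not powers of \<open>\<rho>\<close> have degree at most two, where
  brackets vanish. Therefore a grade part of the normal form that lies in the image of a level map
  is zero, and a complement of that image can be chosen to contain it
  (\<open>normal_form_not_removable\<close>). The same dichotomy shows that only the multiples of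
  \<open>v - \<Theta>\<^sup>0\<^sub>0\<close> commute with \<open>v\<close> when the restriction is nonzero (\<open>commuting_is_multiple\<close>).
\<close>

section \<open>Coefficients and total degrees\<close>

lemma coeff3_add [simp]: "coeff3 (f + g) a b c = coeff3 f a b c + coeff3 g a b c"
  by (simp add: coeff3_def)

lemma coeff3_diff [simp]: "coeff3 (f - g) a b c = coeff3 f a b c - coeff3 g a b c"
  by (simp add: coeff3_def)

lemma coeff3_zero [simp]: "coeff3 0 a b c = 0"
  by (simp add: coeff3_def)

lemma coeff3_sum: "coeff3 (\<Sum>i\<in>I. f i) a b c = (\<Sum>i\<in>I. coeff3 (f i) a b c)"
  by (simp add: coeff3_def fps_sum_nth)

lemma coeff3_const_mult [simp]: "coeff3 (const3 s * f) a b c = (s :: 'a::comm_ring_1) * coeff3 f a b c"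
  by (simp add: coeff3_def const3_def)

lemma coeff3_smul [simp]: "coeff3 (smul s V $ j) a b c = s * coeff3 (V $ j) a b c"
  by (simp add: smul_def)

lemma coeff3_mult:
  "coeff3 (f * g :: 'a::comm_ring_1 fps3) a b c =
     (\<Sum>i=0..c. \<Sum>j=0..b. \<Sum>k=0..a. coeff3 f k j i * coeff3 g (a - k) (b - j) (c - i))"
  by (simp add: coeff3_def fps_mult_nth fps_sum_nth)

lemma coeff3_diff_x: "coeff3 (diff_x f) a b c = of_nat (a + 1) * coeff3 f (a + 1) b c"
  by (simp add: coeff3_def diff_x_def)

lemma coeff3_diff_y: "coeff3 (diff_y f) a b c = of_nat (b + 1) * coeff3 f a (b + 1) c"
proof -
  have "(of_nat (b + 1) :: 'a fps) = fps_const (of_nat (b + 1))"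
    by (simp only: fps_of_nat)
  then show ?thesis
    by (simp only: coeff3_def diff_y_def fps_nth_Abs_fps fps_deriv_nth
        fps_mult_left_const_nth)
qed

lemma coeff3_diff_z: "coeff3 (diff_z f) a b c = of_nat (c + 1) * coeff3 f a b (c + 1)"
proof -
  have "(of_nat (c + 1) :: 'a fps fps) = fps_const (fps_const (of_nat (c + 1)))"
    by (simp only: fps_of_nat)
  then show ?thesis
    by (simp only: coeff3_def diff_z_def fps_deriv_nth fps_mult_left_const_nth)
qed

lemma vfield_eqI:
  "(\<And>j a b c. coeff3 (V $ j) a b c = coeff3 (W $ j) a b c) \<Longrightarrow> V = W"
  by (simp add: vec_eq_iff fps_eq_iff coeff3_def)

text \<open>Homogeneous pieces and tails of formal sums are both handled through the set of total degrees
  in \<open>x\<close>, \<open>y\<close>, \<open>z\<close> that occur in a field: convergence questions become statements about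
  which degrees are absent.\<close>

definition degrees_in :: "nat set \<Rightarrow> 'a::comm_ring_1 vfield \<Rightarrow> bool" where
  "degrees_in A V \<longleftrightarrow> (\<forall>j a b c. coeff3 (V $ j) a b c \<noteq> 0 \<longrightarrow> a + b + c \<in> A)"

definition fps_degrees_in :: "nat set \<Rightarrow> 'a::comm_ring_1 fps3 \<Rightarrow> bool" where
  "fps_degrees_in A f \<longleftrightarrow> (\<forall>a b c. coeff3 f a b c \<noteq> 0 \<longrightarrow> a + b + c \<in> A)"

lemma degrees_in_iff: "degrees_in A V \<longleftrightarrow> (\<forall>j. fps_degrees_in A (V $ j))"
  by (auto simp: degrees_in_def fps_degrees_in_def)

lemma fps_degrees_in_mult:
  fixes f g :: "'a::comm_ring_1 fps3"
  assumes "fps_degrees_in A f" "fps_degrees_in B g"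
  shows "fps_degrees_in {n. \<exists>p\<in>A. \<exists>q\<in>B. n = p + q} (f * g)"
  unfolding fps_degrees_in_def
proof (intro allI impI)
  fix a b c assume "coeff3 (f * g) a b c \<noteq> 0"
  then obtain i where i: "i \<in> {0..c}"
      "(\<Sum>j=0..b. \<Sum>k=0..a. coeff3 f k j i * coeff3 g (a - k) (b - j) (c - i)) \<noteq> 0"
    unfolding coeff3_mult by (rule sum.not_neutral_contains_not_neutral)
  from i(2) obtain j where j: "j \<in> {0..b}"
      "(\<Sum>k=0..a. coeff3 f k j i * coeff3 g (a - k) (b - j) (c - i)) \<noteq> 0"
    by (rule sum.not_neutral_contains_not_neutral)
  from j(2) obtain k where k: "k \<in> {0..a}"
      "coeff3 f k j i * coeff3 g (a - k) (b - j) (c - i) \<noteq> 0"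
    by (rule sum.not_neutral_contains_not_neutral)
  then have "coeff3 f k j i \<noteq> 0" "coeff3 g (a - k) (b - j) (c - i) \<noteq> 0"
    by auto
  then have "k + j + i \<in> A" "(a - k) + (b - j) + (c - i) \<in> B"
    using assms by (auto simp: fps_degrees_in_def)
  moreover have "a + b + c = (k + j + i) + ((a - k) + (b - j) + (c - i))"
    using i(1) j(1) k(1) by auto
  ultimately show "a + b + c \<in> {n. \<exists>p\<in>A. \<exists>q\<in>B. n = p + q}"
    by blast
qed

lemma fps_degrees_in_add:
  "fps_degrees_in A f \<Longrightarrow> fps_degrees_in A g \<Longrightarrow> fps_degrees_in A (f + g)"
  unfolding fps_degrees_in_def coeff3_add by (metis add_0)

lemma fps_degrees_in_diff:
  "fps_degrees_in A f \<Longrightarrow> fps_degrees_in A g \<Longrightarrow> fps_degrees_in A (f - g)"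
  unfolding fps_degrees_in_def coeff3_diff by (metis diff_0_right)

lemma fps_degrees_in_mono: "fps_degrees_in A f \<Longrightarrow> A \<subseteq> B \<Longrightarrow> fps_degrees_in B f"
  unfolding fps_degrees_in_def by blast

lemma degrees_in_mono: "degrees_in A V \<Longrightarrow> A \<subseteq> B \<Longrightarrow> degrees_in B V"
  unfolding degrees_in_def by blast

lemma degrees_in_add: "degrees_in A V \<Longrightarrow> degrees_in A W \<Longrightarrow> degrees_in A (V + W)"
  by (simp add: degrees_in_iff fps_degrees_in_add)

lemma degrees_in_zero: "degrees_in A 0"
  by (simp add: degrees_in_def)

lemma degrees_in_sum:
  "(\<And>i. i \<in> I \<Longrightarrow> degrees_in A (V i)) \<Longrightarrow> degrees_in A (\<Sum>i\<in>I. V i)"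
  by (induction I rule: infinite_finite_induct) (auto simp: degrees_in_zero degrees_in_add)

lemma degrees_in_smul: "degrees_in A V \<Longrightarrow> degrees_in A (smul s V)"
  unfolding degrees_in_def coeff3_smul by (metis mult_zero_right)

lemma fps_degrees_in_derivs:
  fixes f :: "'a::comm_ring_1 fps3"
  assumes "fps_degrees_in A f"
  shows "fps_degrees_in {n. n + 1 \<in> A} (diff_x f)" "fps_degrees_in {n. n + 1 \<in> A} (diff_y f)"
    "fps_degrees_in {n. n + 1 \<in> A} (diff_z f)"
proof -
  have A: "a + b + c \<in> A" if "coeff3 f a b c \<noteq> 0" for a b c
    using assms that unfolding fps_degrees_in_def by blast
  show "fps_degrees_in {n. n + 1 \<in> A} (diff_x f)"
    unfolding fps_degrees_in_def
  proof (intro allI impI)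
    fix a b c assume "coeff3 (diff_x f) a b c \<noteq> 0"
    then show "a + b + c \<in> {n. n + 1 \<in> A}"
      using A[of "a + 1" b c] by (cases "coeff3 f (a + 1) b c = 0") (auto simp: coeff3_diff_x)
  qed
  show "fps_degrees_in {n. n + 1 \<in> A} (diff_y f)"
    unfolding fps_degrees_in_def
  proof (intro allI impI)
    fix a b c assume "coeff3 (diff_y f) a b c \<noteq> 0"
    then show "a + b + c \<in> {n. n + 1 \<in> A}"
      using A[of a "b + 1" c] by (cases "coeff3 f a (b + 1) c = 0") (auto simp: coeff3_diff_y)
  qed
  show "fps_degrees_in {n. n + 1 \<in> A} (diff_z f)"
    unfolding fps_degrees_in_def
  proof (intro allI impI)
    fix a b c assume "coeff3 (diff_z f) a b c \<noteq> 0"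
    then show "a + b + c \<in> {n. n + 1 \<in> A}"
      using A[of a b "c + 1"] by (cases "coeff3 f a b (c + 1) = 0") (auto simp: coeff3_diff_z)
  qed
qed

lemma fps_degrees_in_vf_apply:
  fixes V :: "'a::comm_ring_1 vfield"
  assumes "degrees_in A V" "fps_degrees_in B f"
  shows "fps_degrees_in {n. \<exists>p\<in>A. \<exists>q\<in>B. n + 1 = p + q} (vf_apply V f)"
proof -
  have *: "fps_degrees_in {n. \<exists>p\<in>A. \<exists>q\<in>B. n + 1 = p + q} (V $ j * h)"
    if "fps_degrees_in {n. n + 1 \<in> B} h" for j h
  proof -
    have "fps_degrees_in {n. \<exists>p\<in>A. \<exists>q\<in>{n. n + 1 \<in> B}. n = p + q} (V $ j * h)"
      using assms(1) that by (intro fps_degrees_in_mult) (auto simp: degrees_in_iff)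
    then show ?thesis
      by (rule fps_degrees_in_mono) (auto, metis add_Suc_right)
  qed
  show ?thesis
    unfolding vf_apply_def
    by (intro fps_degrees_in_add * fps_degrees_in_derivs assms(2))
qed

lemma degrees_in_lie:
  fixes V W :: "'a::comm_ring_1 vfield"
  assumes "degrees_in A V" "degrees_in B W"
  shows "degrees_in {n. \<exists>p\<in>A. \<exists>q\<in>B. n + 1 = p + q} (lie V W)"
  unfolding degrees_in_iff
proof
  fix j
  have "fps_degrees_in {n. \<exists>p\<in>A. \<exists>q\<in>B. n + 1 = p + q} (vf_apply V (W $ j))"
    using assms by (intro fps_degrees_in_vf_apply) (auto simp: degrees_in_iff)
  moreover have "fps_degrees_in {n. \<exists>p\<in>A. \<exists>q\<in>B. n + 1 = p + q} (vf_apply W (V $ j))"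
    by (rule fps_degrees_in_mono[OF fps_degrees_in_vf_apply[of B W A "V $ j"]])
      (use assms in \<open>fastforce simp: degrees_in_iff add.commute\<close>)+
  ultimately show "fps_degrees_in {n. \<exists>p\<in>A. \<exists>q\<in>B. n + 1 = p + q} (lie V W $ j)"
    by (simp add: lie_def fps_degrees_in_diff)
qed

lemma fps_degrees_in_vars:
  "fps_degrees_in {1} (var_x :: 'a::comm_ring_1 fps3)" "fps_degrees_in {1} (var_y :: 'a fps3)"
  "fps_degrees_in {1} (var_z :: 'a fps3)" "fps_degrees_in {0} (1 :: 'a fps3)"
  unfolding fps_degrees_in_def coeff3_def var_x_def var_y_def var_z_def
  by (auto simp: fps_X_def split: if_splits)

lemma fps_degrees_in_power:
  assumes "fps_degrees_in {d} (f :: 'a::comm_ring_1 fps3)"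
  shows "fps_degrees_in {m * d} (f ^ m)"
proof (induction m)
  case (Suc m)
  show ?case
    using fps_degrees_in_mult[OF assms Suc.IH] by (auto elim: fps_degrees_in_mono)
qed (simp add: fps_degrees_in_vars)

lemma fps_degrees_in_const_mult:
  "fps_degrees_in A f \<Longrightarrow> fps_degrees_in A (const3 s * f)"
  unfolding fps_degrees_in_def coeff3_const_mult by (metis mult_zero_right)

lemma degrees_in_E0: "degrees_in {1} E0"
  unfolding degrees_in_iff forall_3 E0_def vector_3
  by (intro conjI fps_degrees_in_vars fps_degrees_in_const_mult)

lemma degrees_in_Theta: "degrees_in {1} Theta"
proof -
  have "fps_degrees_in {1} (0 - var_y :: 'a fps3)" "fps_degrees_in {1} (0 :: 'a fps3)"
    using fps_degrees_in_diff[of "{1}" "0 :: 'a fps3"] fps_degrees_in_vars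
    by (auto simp: fps_degrees_in_def)
  then show ?thesis
    unfolding degrees_in_iff forall_3 Theta_def vector_3
    using fps_degrees_in_vars(3)[where 'a='a] by simp
qed

text \<open>The grade is the total degree minus one, so it is visible on the monomials in \<open>x\<close>, \<open>y\<close>, \<open>z\<close>;
  this is what makes grade decompositions unique.\<close>

lemma degrees_in_E:
  assumes "l \<le> k"
  shows "degrees_in {Suc (E_grade l k)} (E l k :: 'a::field_char_0 vfield)"
  unfolding degrees_in_iff
proof
  fix j
  have "fps_degrees_in {2} ((var_y :: 'a fps3)\<^sup>2)" "fps_degrees_in {2} ((var_z :: 'a fps3)\<^sup>2)"
    using fps_degrees_in_power[of 1 _ 2] fps_degrees_in_vars by fastforce+
  then have "fps_degrees_in {2} (var_y\<^sup>2 + var_z\<^sup>2 :: 'a fps3)"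
    by (rule fps_degrees_in_add)
  then have r: "fps_degrees_in {(k - l) * 2} ((var_y\<^sup>2 + var_z\<^sup>2 :: 'a fps3) ^ (k - l))"
    by (rule fps_degrees_in_power)
  have x: "fps_degrees_in {l * 1} (var_x ^ l :: 'a fps3)"
    by (rule fps_degrees_in_power) (rule fps_degrees_in_vars)
  have e: "fps_degrees_in {1} (E0 $ j :: 'a fps3)"
    using degrees_in_E0[where 'a='a] by (simp only: degrees_in_iff)
  show "fps_degrees_in {Suc (E_grade l k)} (E l k $ j :: 'a fps3)"
    using assms fps_degrees_in_mult[OF fps_degrees_in_mult[OF x r] e]
    by (auto simp: E_def E_grade_def elim!: fps_degrees_in_mono)
qed

text \<open>In the terms of the first component that are free of \<open>z\<close>, the field \<open>E l k\<close> is the single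
  monomial \<open>x\<^sup>l\<^sup>+\<^sup>1 y\<^sup>2\<^sup>(\<^sup>k\<^sup>-\<^sup>l\<^sup>)\<close>. So the coefficient of \<open>E l k\<close> in a formal sum can be read off
  there.\<close>

lemma coeff3_E:
  "coeff3 (E l k $ 1) a b 0 = (if a = l + 1 \<and> b = 2 * (k - l) then 1 else 0 :: 'a::field_char_0)"
proof -
  have p0: "fps_nth (f ^ m) 0 = fps_nth f 0 ^ m" for f :: "'a fps3" and m
    by (rule fps_nth_power_0)
  have "fps_nth (E l k $ 1 :: 'a fps3) 0 =
      fps_const fps_X ^ l * (fps_X\<^sup>2) ^ (k - l) * fps_const fps_X"
    by (simp add: E_def E0_def vector_3 p0 var_x_def var_y_def var_z_def)
  also have "\<dots> = fps_const (fps_X ^ (l + 1)) * fps_X ^ (2 * (k - l))"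
    by (simp add: fps_const_power power_mult[symmetric] mult.assoc mult.left_commute
        flip: fps_const_mult)
  finally show ?thesis
    by (auto simp: coeff3_def)
qed


section \<open>Vector fields as power series in the degree\<close>

lemma coeff3_formal_sum:
  assumes "finite J" "J \<subseteq> I" "\<And>i. i \<in> I - J \<Longrightarrow> coeff3 (F i $ j) a b c = 0"
  shows "coeff3 (formal_sum F I $ j) a b c = (\<Sum>i\<in>J. coeff3 (F i $ j) a b c)"
proof -
  have "coeff3 (formal_sum F I $ j) a b c =
      (\<Sum>i | i \<in> I \<and> coeff3 (F i $ j) a b c \<noteq> 0. coeff3 (F i $ j) a b c)"
    by (simp add: formal_sum_def coeff3_def)
  also have "\<dots> = (\<Sum>i\<in>J. coeff3 (F i $ j) a b c)"
    using assms by (intro sum.mono_neutral_left) auto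
  finally show ?thesis .
qed

text \<open>A formal sum of homogeneous fields of different degrees is locally finite, as at most one member
  has a given monomial.\<close>

lemma coeff3_formal_sum_graded:
  assumes "\<And>i. i \<in> I \<Longrightarrow> degrees_in {Suc i} (F i)"
  shows "coeff3 (formal_sum F I $ j) a b c =
    (if a + b + c = 0 \<or> a + b + c - 1 \<notin> I then 0 else coeff3 (F (a + b + c - 1) $ j) a b c)"
proof -
  have z: "i = a + b + c - 1 \<and> a + b + c \<noteq> 0" if "i \<in> I" "coeff3 (F i $ j) a b c \<noteq> 0" for i
    using assms[OF that(1)] that(2) by (force simp: degrees_in_def)
  show ?thesis
  proof (cases "a + b + c = 0 \<or> a + b + c - 1 \<notin> I")
    case True
    then show ?thesis
      using z by (subst coeff3_formal_sum[of "{}"]) auto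
  next
    case False
    then show ?thesis
      using z by (subst coeff3_formal_sum[of "{a + b + c - 1}"]) auto
  qed
qed

text \<open>A power series \<open>f\<close> in \<open>x\<close> and \<open>\<rho>\<close> is stored by degrees: the polynomial \<open>fps_nth f k\<close> is the
  homogeneous part of degree \<open>k\<close> at \<open>\<rho> = 1\<close>, so that its \<open>l\<close>-th coefficient belongs to
  \<open>x\<^sup>l \<rho>\<^sup>k\<^sup>-\<^sup>l\<close>. The terms of grade \<open>n\<close> are those with \<open>l = 2 k - n\<close>, and \<open>l \<le> k\<close> means \<open>k \<le> n\<close>.\<close>

definition graded :: "'a::field_char_0 poly fps \<Rightarrow> nat \<Rightarrow> 'a vfield" where
  "graded f n = (\<Sum>k | k \<le> n \<and> n \<le> 2 * k. smul (coeff (fps_nth f k) (2 * k - n)) (E (2 * k - n) k))"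

definition field_of :: "'a::field_char_0 poly fps \<Rightarrow> 'a vfield" where
  "field_of f = formal_sum (graded f) UNIV"

text \<open>The condition on degrees says that the polynomials do come from homogeneous polynomials in
  \<open>x\<close> and \<open>\<rho>\<close>, and the vanishing constant term excludes \<open>E 0 0\<close>.\<close>

definition admissible :: "'a::field_char_0 poly fps \<Rightarrow> bool" where
  "admissible f \<longleftrightarrow> fps_nth f 0 = 0 \<and> (\<forall>k. degree (fps_nth f k) \<le> k)"

definition monomial :: "nat \<Rightarrow> nat \<Rightarrow> 'a::comm_ring_1 poly fps" where
  "monomial l k = Abs_fps (\<lambda>j. if j = k then monom 1 l else 0)"

text \<open>The inverse of \<open>field_of\<close>, by the coefficients that \<open>coeff3_E\<close> isolates.\<close>

definition symbol :: "'a::field_char_0 vfield \<Rightarrow> 'a poly fps" where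
  "symbol V = Abs_fps (\<lambda>k. if k = 0 then 0 else
     (\<Sum>l\<le>k. monom (coeff3 (V $ 1) (l + 1) (2 * (k - l)) 0) l))"

lemma degrees_in_graded: "degrees_in {Suc n} (graded f n)"
  unfolding graded_def
proof (intro degrees_in_sum degrees_in_smul)
  fix k assume "k \<in> {k. k \<le> n \<and> n \<le> 2 * k}"
  then show "degrees_in {Suc n} (E (2 * k - n) k)"
    by (intro degrees_in_mono[OF degrees_in_E]) (auto simp: E_grade_def)
qed

lemma coeff3_field_of:
  "coeff3 (field_of f $ j) a b c =
     (if a + b + c = 0 then 0 else coeff3 (graded f (a + b + c - 1) $ j) a b c)"
  unfolding field_of_def by (subst coeff3_formal_sum_graded) (auto intro: degrees_in_graded)

lemma smul_simps [simp]:
  "smul s (V + W) = smul s V + smul s W" "smul (s + t) V = smul s V + smul t V"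
  "smul s (V - W) = smul s V - smul s W" "smul (s - t) V = smul s V - smul t V"
  "smul s (smul t V) = smul (s * t) V" "smul 0 V = 0" "smul s 0 = 0" "smul 1 V = V"
  for V W :: "'a::field_char_0 vfield"
  by (simp_all add: vf.scale_right_distrib vf.scale_left_distrib vf.scale_right_diff_distrib
      vf.scale_left_diff_distrib)

lemma graded_linear:
  "graded (f + g) n = graded f n + graded g n"
  "graded (f - g) n = graded f n - graded g n"
  "graded (fps_const [:s:] * f) n = smul s (graded f n)"
  by (simp_all add: graded_def sum.distrib sum_subtractf vf.scale_sum_right)

lemma field_of_linear:
  "field_of (f + g) = field_of f + field_of g"
  "field_of (f - g) = field_of f - field_of g"
  "field_of (fps_const [:s:] * f) = smul s (field_of f)"
  by (rule vfield_eqI; simp add: coeff3_field_of graded_linear)+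

lemma field_of_zero [simp]: "field_of 0 = 0"
  using field_of_linear(2)[of 0 0] by simp

lemma field_of_sum: "field_of (\<Sum>i\<in>I. f i) = (\<Sum>i\<in>I. field_of (f i))"
  by (induction I rule: infinite_finite_induct) (auto simp: field_of_linear)

lemma graded_cong:
  "(\<And>k. k \<le> n \<Longrightarrow> fps_nth f k = fps_nth g k) \<Longrightarrow> graded f n = graded g n"
  unfolding graded_def by (intro sum.cong) auto

lemma degrees_in_field_of:
  assumes "\<And>k. k \<le> N \<Longrightarrow> fps_nth f k = 0"
  shows "degrees_in {n. N + 1 < n} (field_of f)"
proof -
  have "graded f n = 0" if "n \<le> N" for n
    using graded_cong[of n f 0] assms that by (simp add: graded_def)
  then have "graded f (n - 1) = 0" if "n \<le> N + 1" for n
    using that by simp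
  then show ?thesis
    unfolding degrees_in_def coeff3_field_of
    by (intro allI impI) (metis (no_types, lifting) coeff3_zero mem_Collect_eq not_less zero_index)
qed

lemma degrees_in_field_of_pos: "degrees_in {n. 0 < n} (field_of f)"
  unfolding degrees_in_def coeff3_field_of by (auto split: if_splits)

lemma graded_monomial:
  assumes "l \<le> k"
  shows "graded (monomial l k) n = (if n = E_grade l k then E l k else 0)"
proof -
  have "graded (monomial l k) n =
      (\<Sum>j | j \<le> n \<and> n \<le> 2 * j. if j = k then (if 2 * k - n = l then E l k else 0) else 0)"
    unfolding graded_def by (rule sum.cong) (auto simp: monomial_def)
  also have "\<dots> = (if k \<le> n \<and> n \<le> 2 * k then (if 2 * k - n = l then E l k else 0) else 0)"
    by (subst sum.delta) auto
  also have "\<dots> = (if n = E_grade l k then E l k else 0)"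
    using assms by (auto simp: E_grade_def)
  finally show ?thesis .
qed

lemma field_of_monomial:
  assumes "l \<le> k"
  shows "field_of (monomial l k) = (E l k :: 'a::field_char_0 vfield)"
proof (rule vfield_eqI)
  fix j a b c
  have "a + b + c = E_grade l k + 1" if "coeff3 (E l k $ j :: 'a fps3) a b c \<noteq> 0"
    using degrees_in_E[OF assms] that by (auto simp: degrees_in_def)
  then show "coeff3 (field_of (monomial l k) $ j) a b c = coeff3 (E l k $ j :: 'a fps3) a b c"
    unfolding coeff3_field_of graded_monomial[OF assms] by force
qed

lemma coeff_symbol:
  "coeff (fps_nth (symbol V) k) l =
     (if 0 < k \<and> l \<le> k then coeff3 (V $ 1) (l + 1) (2 * (k - l)) 0 else 0)"
  by (auto simp: symbol_def coeff_sum)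

lemma coeff3_graded:
  "coeff3 (graded f n $ 1) a b 0 =
     (\<Sum>k | k \<le> n \<and> n \<le> 2 * k. if a = 2 * k - n + 1 \<and> b = 2 * (n - k)
        then coeff (fps_nth f k) (2 * k - n) else 0)"
  unfolding graded_def sum_component coeff3_sum coeff3_smul coeff3_E
  by (rule sum.cong) auto

lemma admissibleD:
  "admissible f \<Longrightarrow> fps_nth f 0 = 0" "admissible f \<Longrightarrow> k < l \<Longrightarrow> coeff (fps_nth f k) l = 0"
  by (auto simp: admissible_def intro!: coeff_eq_0 dest: spec[of _ k])

lemma symbol_field_of:
  assumes "admissible f"
  shows "symbol (field_of f) = f"
proof (rule fps_ext, rule poly_eqI)
  fix k l
  show "coeff (fps_nth (symbol (field_of f)) k) l = coeff (fps_nth f k) l"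
  proof (cases "0 < k \<and> l \<le> k")
    case True
    let ?n = "2 * k - l"
    have "l + 1 + 2 * (k - l) + 0 = ?n + 1"
      using True by linarith
    then have "coeff (fps_nth (symbol (field_of f)) k) l =
        coeff3 (graded f ?n $ 1) (l + 1) (2 * (k - l)) 0"
      using True by (simp only: coeff_symbol coeff3_field_of) simp
    also have "\<dots> = (\<Sum>i | i \<le> ?n \<and> ?n \<le> 2 * i. if i = k then coeff (fps_nth f k) l else 0)"
      unfolding coeff3_graded using True by (intro sum.cong) auto
    also have "\<dots> = coeff (fps_nth f k) l"
      using True by (subst sum.delta) auto
    finally show ?thesis .
  next
    case False
    then show ?thesis
      using admissibleD[OF assms] by (auto simp: coeff_symbol)
  qed
qed

lemma admissible_symbol: "admissible (symbol V)"
  by (auto simp: admissible_def symbol_def intro!: degree_sum_le degree_monom_le order.trans[OF degree_monom_le])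

lemma admissible_linear:
  "admissible f \<Longrightarrow> admissible g \<Longrightarrow> admissible (f + g)"
  "admissible f \<Longrightarrow> admissible g \<Longrightarrow> admissible (f - g)"
  "admissible f \<Longrightarrow> admissible (fps_const [:s:] * f)" "admissible 0"
  by (auto simp: admissible_def degree_add_le degree_diff_le intro: order.trans[OF degree_smult_le])

lemma admissible_monomial: "(l, k) \<in> E_indices \<Longrightarrow> admissible (monomial l k)"
  by (auto simp: admissible_def monomial_def E_indices_def intro: order.trans[OF degree_monom_le])

lemma symbol_E: "(l, k) \<in> E_indices \<Longrightarrow> symbol (E l k :: 'a::field_char_0 vfield) = monomial l k"
  using symbol_field_of[OF admissible_monomial, of l k, where 'a='a]
    field_of_monomial[of l k, where 'a='a]
  by (auto simp: E_indices_def)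

lemma symbol_linear:
  "symbol (V + W) = symbol V + symbol W" "symbol (smul s V) = fps_const [:s:] * symbol V"
  by (auto simp: fps_eq_iff poly_eq_iff coeff_symbol)

lemma graded_symbol:
  fixes V :: "'a::field_char_0 vfield"
  assumes "V \<in> E_space n"
  shows "graded (symbol V) n = V"
  using assms unfolding E_space_def
proof (induction rule: vf.span_induct_alt)
  case base
  show ?case
    by (auto simp: graded_def coeff_symbol intro!: sum.neutral)
next
  case (step s V W)
  then obtain l k where "(l, k) \<in> E_indices" "E_grade l k = n" "V = E l k"
    by auto
  then have "graded (symbol V) n = V"
    using symbol_E[of l k, where 'a='a] graded_monomial[of l k n, where 'a='a] by (auto simp: E_indices_def)
  then show ?case
    using step by (simp add: symbol_linear graded_linear)
qed

lemma graded_in_E_space: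
  assumes "1 \<le> n"
  shows "graded f n \<in> E_space n"
  unfolding graded_def E_space_def
proof (intro vf.span_sum vf.span_scale vf.span_base)
  fix k assume "k \<in> {k. k \<le> n \<and> n \<le> 2 * k}"
  then show "E (2 * k - n) k \<in> {E l k |l k. (l, k) \<in> E_indices \<and> E_grade l k = n}"
    using assms
    by (intro CollectI exI[of _ "2 * k - n"] exI[of _ k]) (auto simp: E_indices_def E_grade_def)
qed

lemma degrees_in_E_space: "V \<in> E_space n \<Longrightarrow> degrees_in {Suc n} V"
  using degrees_in_graded[of n "symbol V"] by (simp add: graded_symbol)

lemma subspace_field_of: "vf.subspace (field_of ` {f. admissible f})"
  unfolding vf.subspace_def
  by (auto intro!: admissible_linear simp flip: field_of_linear)
    (auto intro!: image_eqI[of _ _ 0] admissible_linear)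

lemma E_space_field_of:
  fixes V :: "'a::field_char_0 vfield"
  assumes "V \<in> E_space n"
  obtains f where "admissible f" "field_of f = V"
proof -
  have "{E l k :: 'a vfield | l k. (l, k) \<in> E_indices \<and> E_grade l k = n} \<subseteq> field_of ` {f. admissible f}"
  proof clarify
    fix l k assume "(l, k) \<in> E_indices"
    then have "field_of (monomial l k) = (E l k :: 'a vfield)" "admissible (monomial l k :: 'a poly fps)"
      by (auto simp: field_of_monomial admissible_monomial) (simp add: E_indices_def field_of_monomial)
    then show "(E l k :: 'a vfield) \<in> field_of ` {f. admissible f}"
      by (metis imageI mem_Collect_eq)
  qed
  then have "(E_space n :: 'a vfield set) \<subseteq> field_of ` {f. admissible f}"
    unfolding E_space_def by (rule vf.span_minimal) (rule subspace_field_of)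
  then show thesis
    using assms that by blast
qed

lemma generators_eq: "generators = field_of ` {f. admissible f}"
proof (intro equalityI subsetI)
  fix S :: "'a vfield" assume "S \<in> generators"
  then obtain Y where Y: "\<And>i. 1 \<le> i \<Longrightarrow> Y i \<in> E_space i" and S: "S = formal_sum Y {1..}"
    by (auto simp: generators_def)
  have c: "coeff3 (S $ j) a b c =
      (if a + b + c \<le> 1 then 0 else coeff3 (Y (a + b + c - 1) $ j) a b c)" for j a b c
    unfolding S using degrees_in_E_space[OF Y] by (subst coeff3_formal_sum_graded) auto
  have "graded (symbol S) n = graded (symbol (Y n)) n" if "1 \<le> n" for n
    unfolding graded_def
  proof (intro sum.cong refl)
    fix k assume "k \<in> {k. k \<le> n \<and> n \<le> 2 * k}"
    then have *: "2 * k - n + 1 + 2 * (k - (2 * k - n)) + 0 = n + 1"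
      by auto
    show "smul (coeff (fps_nth (symbol S) k) (2 * k - n)) (E (2 * k - n) k) =
        smul (coeff (fps_nth (symbol (Y n)) k) (2 * k - n)) (E (2 * k - n) k)"
      using that by (simp only: coeff_symbol c *) simp
  qed
  then have "graded (symbol S) n = Y n" if "1 \<le> n" for n
    using that Y graded_symbol by metis
  moreover have "graded (symbol S) 0 = 0"
    by (simp add: graded_def symbol_def)
  ultimately have "S = field_of (symbol S)"
    by (intro vfield_eqI) (auto simp: c coeff3_field_of not_less le_Suc_eq)
  then show "S \<in> field_of ` {f. admissible f}"
    using admissible_symbol by blast
next
  fix S :: "'a vfield" assume "S \<in> field_of ` {f. admissible f}"
  then obtain f where f: "admissible f" "S = field_of f"
    by auto
  have "graded f 0 = 0"
    using f(1) by (simp add: graded_def admissible_def)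
  then have "S = formal_sum (graded f) {1..}"
    unfolding f(2) by (intro vfield_eqI, subst coeff3_formal_sum_graded)
      (auto intro: degrees_in_graded simp: coeff3_field_of le_Suc_eq)
  then show "S \<in> generators"
    unfolding generators_def using graded_in_E_space by auto
qed


section \<open>The bracket of power series\<close>

definition bracket :: "'b::comm_ring_1 fps \<Rightarrow> 'b fps \<Rightarrow> 'b fps" where
  "bracket f g = f * (fps_X * fps_deriv g) - g * (fps_X * fps_deriv f)"

lemma euler_nth: "fps_nth (fps_X * fps_deriv f) n = of_nat n * fps_nth f n"
  for f :: "'b::comm_ring_1 fps"
  by (cases n) auto

text \<open>The factor \<open>of_nat (n - i) - of_nat i\<close> is the structure constant of the Lie algebra in the
  degrees \<open>i\<close> and \<open>n - i\<close>.\<close>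

lemma bracket_nth:
  "fps_nth (bracket f g) n =
     (\<Sum>i=0..n. fps_nth f i * fps_nth g (n - i) * (of_nat (n - i) - of_nat i))"
proof -
  have "fps_nth (bracket f g) n = fps_nth (f * (fps_X * fps_deriv g)) n
      - fps_nth ((fps_X * fps_deriv f) * g) n"
    by (simp only: bracket_def mult.commute fps_sub_nth)
  also have "\<dots> = (\<Sum>i=0..n. fps_nth f i * (of_nat (n - i) * fps_nth g (n - i)))
      - (\<Sum>i=0..n. (of_nat i * fps_nth f i) * fps_nth g (n - i))"
    unfolding fps_mult_nth[of f] fps_mult_nth[of _ g] euler_nth ..
  finally show ?thesis
    by (simp add: sum_subtractf[symmetric] algebra_simps)
qed

lemma bracket_linear:
  "bracket (f + f') g = bracket f g + bracket f' g"
  "bracket f (g + g') = bracket f g + bracket f g'"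
  "bracket (f - f') g = bracket f g - bracket f' g"
  "bracket f (g - g') = bracket f g - bracket f g'"
  "bracket (fps_const c * f) g = fps_const c * bracket f g"
  "bracket f (fps_const c * g) = fps_const c * bracket f g"
  "bracket 0 g = 0" "bracket f 0 = 0" "bracket f f = 0"
  by (simp_all add: bracket_def algebra_simps)

text \<open>A generator without constant term raises the order; this gives the convergence of the
  exponential series.\<close>

lemma bracket_vanishes:
  assumes "fps_nth s 0 = 0" "\<And>k. k \<le> m \<Longrightarrow> fps_nth g k = 0" "k \<le> Suc m"
  shows "fps_nth (bracket s g) k = 0"
  unfolding bracket_nth
proof (rule sum.neutral, rule ballI)
  fix i assume "i \<in> {0..k}"
  then show "fps_nth s i * fps_nth g (k - i) * (of_nat (k - i) - of_nat i) = 0"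
    using assms(1) assms(2)[of "k - i"] assms(3) by (cases i) auto
qed

lemma bracket_iter_vanishes:
  assumes "fps_nth s 0 = 0" "\<And>k. k \<le> N \<Longrightarrow> fps_nth g k = 0" "k \<le> N + m"
  shows "fps_nth ((bracket s ^^ m) g) k = 0"
  using assms(3)
proof (induction m arbitrary: k)
  case (Suc m)
  then show ?case
    using bracket_vanishes[OF assms(1), of "N + m" "(bracket s ^^ m) g" k] by simp
qed (use assms(2) in simp)

lemma monomial_eq: "monomial l k = fps_const (monom 1 l) * fps_X ^ k"
  by (auto simp: monomial_def fps_eq_iff)

lemma bracket_monomial:
  "bracket (monomial l k) (monomial m n) =
     fps_const [:of_nat n - of_nat k:] * monomial (l + m) (k + n)"
proof -
  have euler: "fps_X * fps_deriv (monomial l k :: 'a poly fps) = fps_const (of_nat k) * monomial l k"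
    for l k
    by (rule fps_ext) (simp add: euler_nth monomial_def del: fps_mult_fps_X_commute)
  have mult: "monomial l k * monomial m n = (monomial (l + m) (k + n) :: 'a poly fps)" for l k m n
    by (simp add: monomial_eq mult_monom power_add mult.left_commute mult.assoc flip: fps_const_mult)
      (simp add: mult_monom fps_const_mult flip: mult.assoc)
  have "bracket (monomial l k) (monomial m n) =
      (fps_const (of_nat n) - fps_const (of_nat k)) * (monomial (l + m) (k + n) :: 'a poly fps)"
    by (simp add: bracket_def euler algebra_simps del: fps_const_sub flip: mult)
  also have "fps_const (of_nat n) - fps_const (of_nat k) =
      fps_const [:of_nat n - of_nat k :: 'a:]"
    by (simp add: of_nat_poly)
  finally show ?thesis .
qed

lemma admissible_bracket:
  assumes "admissible f" "admissible g"
  shows "admissible (bracket f g)"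
  unfolding admissible_def
proof (intro conjI allI)
  show "fps_nth (bracket f g) 0 = 0"
    using assms by (simp add: bracket_nth admissible_def)
  fix n
  show "degree (fps_nth (bracket f g) n) \<le> n"
    unfolding bracket_nth
  proof (rule degree_sum_le)
    fix i assume i: "i \<in> {0..n}"
    have "degree (fps_nth f i * fps_nth g (n - i)) \<le> i + (n - i)"
      using assms by (intro order.trans[OF degree_mult_le] add_mono) (auto simp: admissible_def)
    moreover have "(of_nat (n - i) - of_nat i :: 'a poly) = [:of_nat (n - i) - of_nat i:]"
      by (simp add: of_nat_poly)
    ultimately show "degree (fps_nth f i * fps_nth g (n - i) * (of_nat (n - i) - of_nat i)) \<le> n"
      using i by (simp add: order.trans[OF degree_smult_le])
  qed simp
qed

lemma admissible_bracket_iter: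
  "admissible s \<Longrightarrow> admissible g \<Longrightarrow> admissible ((bracket s ^^ m) g)"
  by (induction m) (auto simp: admissible_bracket)

lemma vf_apply_linear:
  "vf_apply (V + W) f = vf_apply V f + vf_apply W f"
  "vf_apply V (f + g) = vf_apply V f + vf_apply V g"
  "vf_apply (smul s V) f = const3 s * vf_apply V f"
  "vf_apply V (const3 s * f) = const3 s * vf_apply V f"
  by (simp_all add: vf_apply_def smul_def diff_x_mult diff_y_mult diff_z_mult algebra_simps)

lemma lie_linear:
  "lie (V + V') W = lie V W + lie V' W" "lie V (W + W') = lie V W + lie V W'"
  "lie (smul s V) W = smul s (lie V W)" "lie V (smul s W) = smul s (lie V W)"
  by (simp_all add: lie_def vec_eq_iff vf_apply_linear(1,2,4) vf_apply_smult smul_def algebra_simps)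

lemma lie_zero [simp]: "lie 0 W = 0" "lie V 0 = 0"
  using lie_linear(1)[of 0 0 W] lie_linear(2)[of V 0 0] by simp_all

lemma lie_sum: "lie (\<Sum>i\<in>I. V i) W = (\<Sum>i\<in>I. lie (V i) W)"
  "lie W (\<Sum>i\<in>I. V i) = (\<Sum>i\<in>I. lie W (V i))"
  by (induction I rule: infinite_finite_induct; simp add: lie_linear)+

text \<open>Identities between finite sums extend to formal sums because a coefficient of a Lie bracket
  depends on finitely many degrees of its arguments only.\<close>

definition truncation :: "nat \<Rightarrow> 'a::field_char_0 poly fps \<Rightarrow> 'a poly fps" where
  "truncation N f =
     (\<Sum>k\<le>N. \<Sum>l\<le>k. fps_const [:coeff (fps_nth f k) l:] * monomial l k)"

lemma truncation_nth:
  assumes "admissible f" "k \<le> N"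
  shows "fps_nth (truncation N f) k = fps_nth f k"
proof (rule poly_eqI)
  fix i
  have "coeff (fps_nth (truncation N f) k) i =
      (\<Sum>k'\<le>N. \<Sum>l\<le>k'. if k' = k then (if l = i then coeff (fps_nth f k) i else 0) else 0)"
    unfolding truncation_def fps_sum_nth coeff_sum
    by (intro sum.cong refl) (auto simp: monomial_def)
  also have "\<dots> = (\<Sum>k'\<le>N. if k' = k then (\<Sum>l\<le>k. if l = i then coeff (fps_nth f k) i else 0) else 0)"
    by (intro sum.cong refl) auto
  also have "\<dots> = (\<Sum>l\<le>k. if l = i then coeff (fps_nth f k) i else 0)"
    using assms(2) by (subst sum.delta) auto
  also have "\<dots> = coeff (fps_nth f k) i"
    using admissibleD(2)[OF assms(1), of k i] by (subst sum.delta) auto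
  finally show "coeff (fps_nth (truncation N f) k) i = coeff (fps_nth f k) i" .
qed

lemma truncation_split:
  assumes "admissible f"
  obtains f' where "f = truncation N f + f'" "\<And>k. k \<le> N \<Longrightarrow> fps_nth f' k = 0"
proof
  show "f = truncation N f + (f - truncation N f)"
    by simp
qed (simp add: truncation_nth[OF assms])

lemma field_of_truncation:
  "field_of (truncation N f) = (\<Sum>k\<le>N. \<Sum>l\<le>k. smul (coeff (fps_nth f k) l) (E l k))"
  unfolding truncation_def field_of_sum field_of_linear
  by (intro sum.cong refl) (simp add: field_of_monomial)

lemma lie_field_of_truncations:
  fixes f g :: "'a::field_char_0 poly fps"
  shows "lie (field_of (truncation N f)) (field_of (truncation N g)) =
    field_of (bracket (truncation N f) (truncation N g))"
proof -
  let ?P = "\<lambda>f g :: 'a poly fps. lie (field_of f) (field_of g) = field_of (bracket f g)"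
  have l: "?P (\<Sum>i\<in>I. F i) g" if "\<And>i. i \<in> I \<Longrightarrow> ?P (F i) g" for F :: "nat \<Rightarrow> 'a poly fps" and I g
    using that
    by (induction I rule: infinite_finite_induct) (auto simp: field_of_linear lie_linear bracket_linear)
  have r: "?P f (\<Sum>i\<in>I. F i)" if "\<And>i. i \<in> I \<Longrightarrow> ?P f (F i)" for F :: "nat \<Rightarrow> 'a poly fps" and I f
    using that
    by (induction I rule: infinite_finite_induct) (auto simp: field_of_linear lie_linear bracket_linear)
  show ?thesis
    unfolding truncation_def
  proof (intro l r)
    fix k l m n :: nat assume "l \<in> {..k}" "m \<in> {..n}"
    then have "?P (monomial l k) (monomial m n)"
      by (simp add: field_of_monomial lie_E_E bracket_monomial field_of_linear)
    then show "?P (fps_const [:coeff (fps_nth f k) l:] * monomial l k)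
        (fps_const [:coeff (fps_nth g n) m:] * monomial m n)"
      by (simp only: field_of_linear lie_linear bracket_linear)
  qed
qed

text \<open>Cut off both arguments behind the total degree of the coefficient under consideration. The tails
  contribute to higher total degrees only, and for the finite sums the claim is bilinear and
  known on the \<open>E l k\<close>.\<close>

lemma lie_field_of:
  fixes f g :: "'a::field_char_0 poly fps"
  assumes "admissible f" "admissible g"
  shows "lie (field_of f) (field_of g) = field_of (bracket f g)"
proof (rule vfield_eqI)
  fix j and a b c :: nat
  let ?N = "a + b + c"
  obtain f' where f: "f = truncation ?N f + f'" "\<And>k. k \<le> ?N \<Longrightarrow> fps_nth f' k = 0"
    by (rule truncation_split[OF assms(1), of ?N]) blast
  obtain g' where g: "g = truncation ?N g + g'" "\<And>k. k \<le> ?N \<Longrightarrow> fps_nth g' k = 0"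
    by (rule truncation_split[OF assms(2), of ?N]) blast
  let ?f = "truncation ?N f" and ?g = "truncation ?N g"
  have low: "coeff3 (V $ j) a b c = 0" if "degrees_in {n. ?N < n} V" for V :: "'a vfield"
    using that unfolding degrees_in_def by blast
  have 1: "coeff3 (lie (field_of f') (field_of g) $ j) a b c = 0"
    by (rule low, rule degrees_in_mono[OF degrees_in_lie[OF degrees_in_field_of[OF f(2)]
        degrees_in_field_of_pos]]) auto
  have 2: "coeff3 (lie (field_of ?f) (field_of g') $ j) a b c = 0"
    by (rule low, rule degrees_in_mono[OF degrees_in_lie[OF degrees_in_field_of_pos
        degrees_in_field_of[OF g(2)]]]) auto
  have "fps_nth (bracket f' g) k = 0" if "k \<le> ?N" for k
    unfolding bracket_nth using f(2) that by (intro sum.neutral) auto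
  then have 3: "coeff3 (field_of (bracket f' g) $ j) a b c = 0"
    by (intro low degrees_in_mono[OF degrees_in_field_of[of ?N]]) auto
  have "fps_nth (bracket ?f g') k = 0" if "k \<le> ?N" for k
    unfolding bracket_nth using g(2) that by (intro sum.neutral) auto
  then have 4: "coeff3 (field_of (bracket ?f g') $ j) a b c = 0"
    by (intro low degrees_in_mono[OF degrees_in_field_of[of ?N]]) auto
  have "lie (field_of f) (field_of g) = lie (field_of ?f) (field_of ?g)
      + lie (field_of ?f) (field_of g') + lie (field_of f') (field_of g)"
    by (metis f(1) g(1) field_of_linear(1) lie_linear(1,2))
  moreover have "bracket f g = bracket ?f ?g + bracket ?f g' + bracket f' g"
    by (metis f(1) g(1) bracket_linear(1,2))
  ultimately show "coeff3 (lie (field_of f) (field_of g) $ j) a b c =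
      coeff3 (field_of (bracket f g) $ j) a b c"
    by (simp add: field_of_linear lie_field_of_truncations 1 2 3 4)
qed

lemma lie_field_of_Theta:
  fixes f :: "'a::field_char_0 poly fps"
  assumes "admissible f"
  shows "lie (field_of f) Theta = 0"
proof (rule vfield_eqI)
  fix j and a b c :: nat
  let ?N = "a + b + c"
  obtain f' where f: "f = truncation ?N f + f'" "\<And>k. k \<le> ?N \<Longrightarrow> fps_nth f' k = 0"
    by (rule truncation_split[OF assms(1), of ?N]) blast
  have "degrees_in {n. ?N < n} (lie (field_of f') Theta)"
    by (rule degrees_in_mono[OF degrees_in_lie[OF degrees_in_field_of[OF f(2)] degrees_in_Theta]]) auto
  then have "coeff3 (lie (field_of f') Theta $ j) a b c = 0"
    unfolding degrees_in_def by blast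
  moreover have "lie (field_of (truncation ?N f)) Theta = 0"
    by (simp add: field_of_truncation lie_sum lie_linear lie_E_Theta)
  ultimately show "coeff3 (lie (field_of f) Theta $ j) a b c = coeff3 (0 $ j) a b c"
    by (subst f(1)) (simp add: field_of_linear lie_linear)
qed


section \<open>The exponential of a bracket\<close>

text \<open>The sum may stop at \<open>m = k\<close>, because the \<open>m\<close>-th iterate starts in degree \<open>m + 1\<close>.\<close>

definition exp_bracket :: "'a::field_char_0 poly fps \<Rightarrow> 'a poly fps \<Rightarrow> 'a poly fps" where
  "exp_bracket s g = Abs_fps (\<lambda>k. \<Sum>m\<le>k. smult (1 / fact m) (fps_nth ((bracket s ^^ m) g) k))"

lemma exp_bracket_nth:
  assumes "fps_nth s 0 = 0" "fps_nth g 0 = 0" "k \<le> N"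
  shows "fps_nth (exp_bracket s g) k = (\<Sum>m\<le>N. smult (1 / fact m) (fps_nth ((bracket s ^^ m) g) k))"
  unfolding exp_bracket_def fps_nth_Abs_fps using assms bracket_iter_vanishes[of s 0 g k]
  by (intro sum.mono_neutral_left) auto

lemma admissible_exp_bracket:
  assumes "admissible s" "admissible g"
  shows "admissible (exp_bracket s g)"
proof -
  have "admissible ((bracket s ^^ m) g)" for m
    by (rule admissible_bracket_iter[OF assms])
  then show ?thesis
    using assms(2) unfolding admissible_def exp_bracket_def
    by (auto intro!: degree_sum_le order.trans[OF degree_smult_le])
qed

lemma exp_ad_field_of:
  fixes s g :: "'a::field_char_0 poly fps"
  assumes "admissible s" "admissible g"
  shows "exp_ad (field_of s) (Theta + field_of g) = Theta + field_of (exp_bracket s g)"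
proof (rule vfield_eqI)
  fix j and a b c :: nat
  let ?N = "a + b + c"
  have 0: "fps_nth s 0 = 0" "fps_nth g 0 = 0"
    using assms by (auto simp: admissible_def)
  have iter: "(lie (field_of s) ^^ m) (Theta + field_of g) =
      (if m = 0 then Theta else 0) + field_of ((bracket s ^^ m) g)" for m
    by (induction m)
      (auto simp: lie_linear lie_field_of_Theta lie_field_of admissible_bracket_iter assms)
  have high: "coeff3 (field_of ((bracket s ^^ m) g) $ j) a b c = 0" if "?N < m" for m
  proof (rule ccontr)
    assume "coeff3 (field_of ((bracket s ^^ m) g) $ j) a b c \<noteq> 0"
    moreover have "degrees_in {n. m + 1 < n} (field_of ((bracket s ^^ m) g))"
      using bracket_iter_vanishes[OF 0(1), of 0 g _ m] 0(2) by (intro degrees_in_field_of) simp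
    ultimately have "?N \<in> {n. m + 1 < n}"
      unfolding degrees_in_def by blast
    then show False
      using that by simp
  qed
  let ?P = "\<Sum>m\<le>?N. fps_const [:1 / fact m:] * (bracket s ^^ m) g"
  have "coeff3 (exp_ad (field_of s) (Theta + field_of g) $ j) a b c =
      (\<Sum>m\<le>?N. 1 / fact m * (coeff3 ((if m = 0 then Theta else 0) $ j) a b c
        + coeff3 (field_of ((bracket s ^^ m) g) $ j) a b c))"
    unfolding exp_ad_def iter
    by (subst coeff3_formal_sum[of "{..?N}"]) (auto simp: high add_divide_distrib)
  also have "\<dots> = (\<Sum>m\<le>?N. if m = 0 then coeff3 (Theta $ j) a b c else 0)
      + (\<Sum>m\<le>?N. 1 / fact m * coeff3 (field_of ((bracket s ^^ m) g) $ j) a b c)"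
    unfolding sum.distrib[symmetric] by (rule sum.cong) (auto simp: algebra_simps)
  also have "\<dots> = coeff3 (Theta $ j) a b c + coeff3 (field_of ?P $ j) a b c"
    by (simp add: field_of_sum field_of_linear coeff3_sum)
  also have "coeff3 (field_of ?P $ j) a b c = coeff3 (field_of (exp_bracket s g) $ j) a b c"
  proof -
    have "fps_nth ?P k = fps_nth (exp_bracket s g) k" if "k \<le> ?N" for k
      unfolding exp_bracket_nth[OF 0 that] by (simp add: fps_sum_nth)
    then have "graded ?P (?N - 1) = graded (exp_bracket s g) (?N - 1)"
      by (intro graded_cong) auto
    then show ?thesis
      unfolding coeff3_field_of by simp
  qed
  finally show "coeff3 (exp_ad (field_of s) (Theta + field_of g) $ j) a b c =
      coeff3 ((Theta + field_of (exp_bracket s g)) $ j) a b c"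
    by simp
qed


section \<open>Restriction to the line where the linear part vanishes\<close>

text \<open>With \<open>\<rho> = 1\<close> in each degree, the line through \<open>x = t \<rho>\<close> is reached by evaluating every homogeneous
  part at \<open>t\<close>.\<close>

definition on_line :: "'a \<Rightarrow> 'a::field_char_0 poly fps \<Rightarrow> 'a fps" where
  "on_line t f = Abs_fps (\<lambda>k. poly (fps_nth f k) t)"

lemma on_line_nth [simp]: "fps_nth (on_line t f) k = poly (fps_nth f k) t"
  by (simp add: on_line_def)

text \<open>The bracket is a combination of products whose coefficients depend on the degrees only, and
  evaluation at a point does not change degrees.\<close>

lemma on_line_bracket: "on_line t (bracket f g) = bracket (on_line t f) (on_line t g)"
  by (rule fps_ext) (simp add: bracket_nth poly_sum)

lemma on_line_bracket_iter:
  "on_line t ((bracket s ^^ m) g) = (bracket (on_line t s) ^^ m) (on_line t g)"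
  by (induction m) (simp_all add: on_line_bracket)

text \<open>The factor \<open>1 - of_nat n\<close> vanishes for \<open>n = 1\<close>: generators of degree one do not act on the linear
  part, and this is the source of the invariance of degree two and of the remaining freedom that
  is used for the term \<open>\<rho>\<^sup>r\<^sup>+\<^sup>1\<close>.\<close>

lemma bracket_leading_left:
  assumes "fps_nth g 0 = 0" "\<And>i. i < n \<Longrightarrow> fps_nth f i = 0"
  shows "k \<le> n \<Longrightarrow> fps_nth (bracket f g) k = 0"
    and "fps_nth (bracket f g) (Suc n) = fps_nth f n * fps_nth g 1 * (1 - of_nat n)"
proof -
  assume k: "k \<le> n"
  show "fps_nth (bracket f g) k = 0"
    unfolding bracket_nth
  proof (rule sum.neutral, rule ballI)
    fix i assume "i \<in> {0..k}"
    then show "fps_nth f i * fps_nth g (k - i) * (of_nat (k - i) - of_nat i) = 0"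
      using assms k by (cases "i < n") auto
  qed
next
  have "fps_nth (bracket f g) (Suc n) =
      (\<Sum>i\<in>{n}. fps_nth f i * fps_nth g (Suc n - i) * (of_nat (Suc n - i) - of_nat i))"
    unfolding bracket_nth
  proof (intro sum.mono_neutral_right ballI)
    fix i assume "i \<in> {0..Suc n} - {n}"
    then show "fps_nth f i * fps_nth g (Suc n - i) * (of_nat (Suc n - i) - of_nat i) = 0"
      using assms by (cases "i < n") (auto simp: le_Suc_eq)
  qed auto
  then show "fps_nth (bracket f g) (Suc n) = fps_nth f n * fps_nth g 1 * (1 - of_nat n)"
    by (simp add: Suc_diff_le)
qed

lemma bracket_leading_right:
  assumes "fps_nth f 0 = 0" "\<And>i. i < r \<Longrightarrow> fps_nth g i = 0"
  shows "k \<le> r \<Longrightarrow> fps_nth (bracket f g) k = 0"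
    and "fps_nth (bracket f g) (Suc r) = fps_nth f 1 * fps_nth g r * (of_nat r - 1)"
proof -
  have flip: "fps_nth (bracket f g) k = - fps_nth (bracket g f) k" for k
    by (simp add: bracket_def)
  show "k \<le> r \<Longrightarrow> fps_nth (bracket f g) k = 0"
    unfolding flip using bracket_leading_left(1)[OF assms, of k] by simp
  show "fps_nth (bracket f g) (Suc r) = fps_nth f 1 * fps_nth g r * (of_nat r - 1)"
    unfolding flip using bracket_leading_left(2)[OF assms] by (simp add: algebra_simps)
qed

text \<open>If the linear part of \<open>f\<close> vanishes where the linear part \<open>L\<close> of \<open>g\<close> does, then it is a multiple
  \<open>c L\<close>. Subtracting \<open>c g\<close> from \<open>f\<close> leaves the bracket with \<open>g\<close> unchanged and raises the order of \<open>f\<close>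
  to some \<open>n \<ge> 2\<close>, so that the bracket begins with the nonzero multiple \<open>(1 - n) f\<^sub>n L\<close> of \<open>L\<close>.\<close>

lemma linear_part_cases:
  fixes g :: "'a::field_char_0 poly fps"
  assumes g: "fps_nth g 0 = 0" "fps_nth g 1 = [:b, a:]" "a \<noteq> 0"
    and f: "admissible f" "poly (fps_nth f 1) (- b / a) = 0"
  obtains (multiple) c where "f = fps_const [:c:] * g"
  | (leading) n where "fps_nth (bracket f g) n \<noteq> 0" "poly (fps_nth (bracket f g) n) (- b / a) = 0"
      "\<And>k. k < n \<Longrightarrow> fps_nth (bracket f g) k = 0"
proof -
  define c where "c = coeff (fps_nth f 1) 1 / a"
  define h where "h = f - fps_const [:c:] * g"
  have hg: "bracket h g = bracket f g"
    by (simp add: h_def bracket_linear)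
  obtain c0 c1 where f1: "fps_nth f 1 = [:c0, c1:]"
  proof -
    have "degree (fps_nth f 1) \<le> 1"
      using f(1) by (simp add: admissible_def)
    then have "fps_nth f 1 = [:coeff (fps_nth f 1) 0, coeff (fps_nth f 1) 1:]"
      by (intro poly_eqI) (auto simp: coeff_pCons coeff_eq_0 split: nat.splits)
    then show thesis
      by (rule that)
  qed
  have "c0 = c * b" "c1 = c * a"
    using f(2) g(3) by (auto simp: c_def f1[unfolded One_nat_def] field_simps)
  then have h01: "fps_nth h 0 = 0" "fps_nth h 1 = 0"
    using f(1) g f1 by (auto simp: h_def admissible_def)
  show thesis
  proof (cases "h = 0")
    case True
    then show thesis
      using multiple[of c] by (simp add: h_def)
  next
    case False
    let ?q = "subdegree h"
    have q: "fps_nth h ?q \<noteq> 0" "\<And>i. i < ?q \<Longrightarrow> fps_nth h i = 0"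
      using False by auto
    then have "2 \<le> ?q"
      using h01 by (metis One_nat_def Suc_1 less_2_cases not_less)
    then have "(1 - of_nat ?q :: 'a poly) \<noteq> 0"
      by (metis Suc_1 Suc_n_not_le_n eq_iff_diff_eq_0 of_nat_1 of_nat_eq_iff)
    moreover have eq: "fps_nth (bracket h g) (Suc ?q) = fps_nth h ?q * [:b, a:] * (1 - of_nat ?q)"
      using bracket_leading_left(2)[of g ?q h, OF g(1) q(2)] g(2) by simp
    ultimately have "fps_nth (bracket h g) (Suc ?q) \<noteq> 0"
      using q(1) g(3) by (simp only: eq mult_eq_0_iff) simp
    moreover have "poly (fps_nth (bracket h g) (Suc ?q)) (- b / a) = 0"
      using g(3) by (simp add: eq)
    moreover have "fps_nth (bracket h g) k = 0" if "k < Suc ?q" for k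
      using bracket_leading_left(1)[of g ?q h k, OF g(1) q(2)] that by simp
    ultimately show thesis
      unfolding hg by (rule leading)
  qed
qed

text \<open>The order of vanishing along the line, bundled with the bound that the vanishing of the linear
  part gives.\<close>

definition line_order :: "'a::field_char_0 \<Rightarrow> nat \<Rightarrow> 'a poly fps \<Rightarrow> bool" where
  "line_order t r g \<longleftrightarrow> 2 \<le> r \<and> (\<forall>k<r. poly (fps_nth g k) t = 0) \<and> poly (fps_nth g r) t \<noteq> 0"

lemma bracket_on_line_leading:
  assumes "line_order t r g" "fps_nth f 0 = 0"
  shows "k \<le> r \<Longrightarrow> poly (fps_nth (bracket f g) k) t = 0"
    and "poly (fps_nth (bracket f g) (Suc r)) t = poly (fps_nth f 1) t * poly (fps_nth g r) t * (of_nat r - 1)"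
  using bracket_leading_right[of "on_line t f" r "on_line t g"] assms
  by (auto simp: line_order_def simp flip: on_line_bracket)

lemma line_order_factor: "line_order t r g \<Longrightarrow> (of_nat r - 1 :: 'a::field_char_0) \<noteq> 0"
  unfolding line_order_def
  by (metis One_nat_def Suc_1 Suc_n_not_le_n eq_iff_diff_eq_0 of_nat_1 of_nat_eq_iff)

text \<open>This is why only the power \<open>\<rho>\<^sup>r\<^sup>+\<^sup>1\<close> can be removed: if the leading part of a bracket does not
  restrict to zero, then by \<open>linear_part_cases\<close> the linear part of \<open>f\<close> does not either, and the leading
  part on the line is the one of degree \<open>r + 1\<close>.\<close>

lemma bracket_pure_leading:
  fixes g :: "'a::field_char_0 poly fps"
  assumes g: "fps_nth g 0 = 0" "fps_nth g 1 = [:b, a:]" "a \<noteq> 0"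
    and gen: "on_line (- b / a) g = 0 \<or> line_order (- b / a) r g"
    and f: "admissible f"
    and lead: "\<And>k. k < n \<Longrightarrow> fps_nth (bracket f g) k = 0"
      "poly (fps_nth (bracket f g) n) (- b / a) \<noteq> 0"
  shows "line_order (- b / a) r g \<and> n = Suc r"
proof -
  have "on_line (- b / a) (bracket f g) \<noteq> 0"
    using lead(2) by (auto simp: fps_eq_iff)
  then have gr: "line_order (- b / a) r g"
    using gen by (auto simp: on_line_bracket bracket_linear)
  have f0: "fps_nth f 0 = 0"
    using f by (simp add: admissible_def)
  have "poly (fps_nth f 1) (- b / a) \<noteq> 0"
  proof
    assume "poly (fps_nth f 1) (- b / a) = 0"
    from g f this show False
    proof (cases rule: linear_part_cases)
      case (multiple c)
      then show False
        using lead(2) by (simp add: bracket_linear)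
    next
      case (leading m)
      then have "n = m"
        using lead by (metis poly_0 nat_neq_iff)
      then show False
        using leading lead(2) by simp
    qed
  qed
  then have "poly (fps_nth (bracket f g) (Suc r)) (- b / a) \<noteq> 0"
    using bracket_on_line_leading(2)[OF gr f0] line_order_factor[OF gr] gr
    by (auto simp: line_order_def)
  then have "n \<le> Suc r"
    using lead(1)[of "Suc r"] by (metis not_less poly_0)
  moreover have "\<not> n \<le> r"
    using bracket_on_line_leading(1)[OF gr f0] lead(2) by blast
  ultimately show ?thesis
    using gr by simp
qed

text \<open>The restriction of the bracket to the line has the coefficient \<open>(r - 1) \<sigma> \<gamma>\<close> in degree \<open>r + 1\<close>, where
  \<open>\<sigma>\<close> is the restricted linear part of \<open>f\<close>. So \<open>\<sigma> = 0\<close>, and \<open>linear_part_cases\<close> applies.\<close>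

lemma commuting_is_multiple:
  fixes g :: "'a::field_char_0 poly fps"
  assumes g: "fps_nth g 0 = 0" "fps_nth g 1 = [:b, a:]" "a \<noteq> 0"
    and gen: "line_order (- b / a) r g"
    and f: "admissible f" "bracket f g = 0"
  obtains c where "f = fps_const [:c:] * g"
proof -
  have "fps_nth f 0 = 0"
    using f(1) by (simp add: admissible_def)
  from bracket_on_line_leading(2)[OF gen this] f(2)
  have "poly (fps_nth f 1) (- b / a) * poly (fps_nth g r) (- b / a) * (of_nat r - 1) = 0"
    by simp
  then have "poly (fps_nth f 1) (- b / a) = 0"
    using line_order_factor[OF gen] gen by (auto simp: line_order_def)
  from g f(1) this show thesis
    by (cases rule: linear_part_cases) (use that f(2) in auto)
qed

text \<open>The lowest term of the bracket is also the lowest term of \<open>exp_bracket s g - g\<close>, as further brackets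
  with \<open>s\<close> raise the order.\<close>

lemma exp_bracket_fixed:
  assumes "fps_nth s 0 = 0" "fps_nth g 0 = 0" "exp_bracket s g = g"
  shows "bracket s g = 0"
proof (rule ccontr)
  assume "bracket s g \<noteq> 0"
  define n where "n = subdegree (bracket s g)"
  have n: "fps_nth (bracket s g) n \<noteq> 0" "\<And>k. k < n \<Longrightarrow> fps_nth (bracket s g) k = 0"
    using \<open>bracket s g \<noteq> 0\<close> by (auto simp: n_def)
  have n1: "1 \<le> n"
    using n(1) assms(1) by (cases n) (auto simp: bracket_nth)
  have high: "fps_nth ((bracket s ^^ m) g) n = 0" if m: "2 \<le> m" for m
  proof -
    have "(bracket s ^^ m) g = (bracket s ^^ (m - 1)) (bracket s g)"
      using m by (metis Suc_diff_1 comp_apply funpow_Suc_right less_le_trans pos2)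
    then show ?thesis
      using bracket_iter_vanishes[OF assms(1), of "n - 1" "bracket s g" n "m - 1"] n(2) n1 m by simp
  qed
  have "fps_nth g n = (\<Sum>m\<le>n. smult (1 / fact m) (fps_nth ((bracket s ^^ m) g) n))"
    using assms(3) exp_bracket_nth[OF assms(1,2), of n n] by simp
  also have "\<dots> = (\<Sum>m\<in>{0, 1}. smult (1 / fact m) (fps_nth ((bracket s ^^ m) g) n))"
  proof (intro sum.mono_neutral_right ballI)
    show "{0, 1} \<subseteq> {..n}" using n1 by auto
    fix i assume "i \<in> {..n} - {0, 1}"
    then have "2 \<le> i" by auto
    then show "smult (1 / fact i) (fps_nth ((bracket s ^^ i) g) n) = 0"
      using high by simp
  qed simp
  finally show False
    using n(1) by simp
qed

lemma exp_bracket_low: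
  assumes "fps_nth s 0 = 0" "fps_nth g 0 = 0"
  shows "fps_nth (exp_bracket s g) 1 = fps_nth g 1" "fps_nth (exp_bracket s g) 2 = fps_nth g 2"
proof -
  have v: "fps_nth ((bracket s ^^ m) g) k = 0" if "k \<le> m" for k m
    using bracket_iter_vanishes[OF assms(1), of 0 g k m] assms(2) that by simp
  show "fps_nth (exp_bracket s g) 1 = fps_nth g 1"
    using v[of 1 1] by (simp add: exp_bracket_def)
  have "fps_nth (bracket s g) 2 = 0"
    using bracket_leading_left(2)[OF assms(2), of 1 s] assms(1) by (simp add: numeral_2_eq_2)
  then show "fps_nth (exp_bracket s g) 2 = fps_nth g 2"
    using v[of 2 2] by (simp add: exp_bracket_def numeral_2_eq_2)
qed

text \<open>The part \<open>s\<^sub>n\<close> of a generator occurs in degree \<open>n + 1\<close> only through its bracket with the linear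
  part: in an iterated bracket \<open>[s\<^sub>i, [s\<^sub>j, g\<^sub>m]]\<close> with \<open>i + j + m = n + 1\<close> all indices are at least one, hence
  \<open>i\<close> and \<open>j\<close> are less than \<open>n\<close>.\<close>

lemma exp_bracket_change:
  fixes s s' :: "'a::field_char_0 poly fps"
  assumes "fps_nth s 0 = 0" "fps_nth g 0 = 0" "1 \<le> n"
    and agree: "\<And>i. i < n \<Longrightarrow> fps_nth s i = fps_nth s' i"
  shows "fps_nth (exp_bracket s g) (Suc n) - fps_nth (exp_bracket s' g) (Suc n) =
    (1 - of_nat n) * (fps_nth s n - fps_nth s' n) * fps_nth g 1"
proof -
  have s'0: "fps_nth s' 0 = 0"
    using agree[of 0] assms by simp
  have v: "fps_nth ((bracket s ^^ m) g) k = 0" "fps_nth ((bracket s' ^^ m) g) k = 0"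
    if "k \<le> m" for k m
    using bracket_iter_vanishes[OF _, of _ 0 g k m] assms(1,2) s'0 that by simp_all
  have low: "fps_nth ((bracket s ^^ m) g) k = fps_nth ((bracket s' ^^ m) g) k" if "k \<le> n" for m k
    using that
  proof (induction m arbitrary: k)
    case (Suc m)
    show ?case
      unfolding funpow.simps comp_apply bracket_nth
    proof (intro sum.cong refl)
      fix i assume i: "i \<in> {0..k}"
      show "fps_nth s i * fps_nth ((bracket s ^^ m) g) (k - i) * (of_nat (k - i) - of_nat i) =
          fps_nth s' i * fps_nth ((bracket s' ^^ m) g) (k - i) * (of_nat (k - i) - of_nat i)"
        using i Suc.prems Suc.IH[of "k - i"] agree[of i] v[of 0 m] by (cases "i < n") auto
    qed
  qed simp
  have high: "fps_nth ((bracket s ^^ m) g) (Suc n) = fps_nth ((bracket s' ^^ m) g) (Suc n)"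
    if m: "2 \<le> m" for m
  proof -
    obtain m' where m': "m = Suc m'" "1 \<le> m'"
      using m by (cases m) auto
    show ?thesis
      unfolding m'(1) funpow.simps comp_apply bracket_nth
    proof (intro sum.cong refl)
      fix i assume i: "i \<in> {0..Suc n}"
      consider "i = 0" | "1 \<le> i" "i < n" | "i = n" | "i = Suc n"
        using i by fastforce
      then show "fps_nth s i * fps_nth ((bracket s ^^ m') g) (Suc n - i) * (of_nat (Suc n - i) - of_nat i) =
          fps_nth s' i * fps_nth ((bracket s' ^^ m') g) (Suc n - i) * (of_nat (Suc n - i) - of_nat i)"
      proof cases
        case 1
        then show ?thesis using assms(1) s'0 by simp
      next
        case 2
        then show ?thesis using agree[of i] low[of "Suc n - i" m'] by simp
      next
        case 3
        then show ?thesis using v[of 1 m'] m'(2) by (simp add: Suc_diff_le)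
      next
        case 4
        then show ?thesis using v[of 0 m'] by simp
      qed
    qed
  qed
  have "fps_nth (bracket s g) (Suc n) - fps_nth (bracket s' g) (Suc n) =
      fps_nth (bracket (s - s') g) (Suc n)"
    by (simp add: bracket_linear)
  also have "\<dots> = (1 - of_nat n) * (fps_nth s n - fps_nth s' n) * fps_nth g 1"
    using bracket_leading_left(2)[OF assms(2), of n "s - s'"] agree by (simp add: mult.assoc mult.commute)
  finally have one: "fps_nth (bracket s g) (Suc n) - fps_nth (bracket s' g) (Suc n) =
      (1 - of_nat n) * (fps_nth s n - fps_nth s' n) * fps_nth g 1" .
  have "fps_nth (exp_bracket s g) (Suc n) - fps_nth (exp_bracket s' g) (Suc n) =
      (\<Sum>m\<le>Suc n. smult (1 / fact m) (fps_nth ((bracket s ^^ m) g) (Suc n)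
         - fps_nth ((bracket s' ^^ m) g) (Suc n)))"
    by (simp add: exp_bracket_def sum_subtractf smult_diff_right del: sum.atMost_Suc)
  also have "\<dots> = (\<Sum>m\<in>{1}. smult (1 / fact m) (fps_nth ((bracket s ^^ m) g) (Suc n)
         - fps_nth ((bracket s' ^^ m) g) (Suc n)))"
  proof (intro sum.mono_neutral_right ballI)
    fix m assume "m \<in> {..Suc n} - {1}"
    then consider "m = 0" | "2 \<le> m"
      by fastforce
    then show "smult (1 / fact m) (fps_nth ((bracket s ^^ m) g) (Suc n)
         - fps_nth ((bracket s' ^^ m) g) (Suc n)) = 0"
      by cases (simp_all add: high)
  qed auto
  finally show ?thesis
    by (simp add: one)
qed


section \<open>The normalizing generator\<close>

text \<open>The parts of the generator are found one after the other. The part of degree \<open>n \<ge> 2\<close> is the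
  quotient by \<open>L\<close> of what the earlier parts leave in degree \<open>n + 1\<close>, divided by the factor
  \<open>n - 1\<close> of \<open>exp_bracket_change\<close>; the remainder of the division is a constant, that is, a multiple of
  \<open>\<rho>\<^sup>n\<^sup>+\<^sup>1\<close>. The linear part \<open>c \<rho>\<close> is still free.\<close>

fun normalizer :: "'a::field_char_0 poly fps \<Rightarrow> 'a \<Rightarrow> nat \<Rightarrow> 'a poly" where
  "normalizer g c n = (if n = 0 then 0 else if n = 1 then [:c:] else
     smult (1 / (of_nat n - 1))
       (fps_nth (exp_bracket (Abs_fps (\<lambda>i. if i < n then normalizer g c i else 0)) g) (Suc n)
         div fps_nth g 1))"

declare normalizer.simps [simp del]

lemma degree_normalizer:
  assumes "admissible g" "fps_nth g 1 = [:b, a:]" "a \<noteq> 0"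
  shows "degree (normalizer g c n) \<le> n"
proof (induction n rule: less_induct)
  case (less n)
  let ?s = "Abs_fps (\<lambda>i. if i < n then normalizer g c i else 0)"
  let ?R = "fps_nth (exp_bracket ?s g) (Suc n)"
  have "admissible ?s"
    using less.IH by (auto simp: admissible_def normalizer.simps[of g c 0])
  then have "degree ?R \<le> Suc n"
    using admissible_exp_bracket[OF _ assms(1)] by (auto simp: admissible_def)
  moreover have "degree (?R mod [:b, a:]) = 0"
    using degree_mod_less[of "[:b, a:]" ?R] assms(3) by auto
  ultimately have "degree (?R - ?R mod [:b, a:]) \<le> Suc n"
    by (intro degree_diff_le) auto
  then have "degree (?R div [:b, a:] * [:b, a:]) \<le> Suc n"
    by (simp only: minus_mod_eq_div_mult)
  then have "degree (?R div [:b, a:]) \<le> n"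
    using assms(3) by (cases "?R div [:b, a:] = 0") (auto simp: degree_mult_eq simp del: mult_pCons_right)
  then show ?case
    by (subst normalizer.simps) (auto simp: assms(2)[unfolded One_nat_def] intro: order.trans[OF degree_smult_le])
qed

lemma normalizing_generator:
  fixes g :: "'a::field_char_0 poly fps"
  assumes "admissible g" "fps_nth g 1 = [:b, a:]" "a \<noteq> 0"
  obtains s where "admissible s" "fps_nth s 1 = [:c:]"
    "\<And>n. 3 \<le> n \<Longrightarrow> degree (fps_nth (exp_bracket s g) n) = 0"
proof
  define s where "s = Abs_fps (normalizer g c)"
  show adm: "admissible s"
    using degree_normalizer[OF assms]
    by (auto simp: admissible_def s_def normalizer.simps[of g c 0])
  show "fps_nth s 1 = [:c:]"
    by (simp add: s_def normalizer.simps)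
  have "degree (fps_nth (exp_bracket s g) (Suc n)) = 0" if n: "2 \<le> n" for n
  proof -
    let ?s = "Abs_fps (\<lambda>i. if i < n then normalizer g c i else 0)"
    let ?R = "fps_nth (exp_bracket ?s g) (Suc n)"
    have nz: "of_nat n - 1 \<noteq> (0 :: 'a)"
      using n by (metis Suc_1 Suc_n_not_le_n eq_iff_diff_eq_0 of_nat_1 of_nat_eq_iff)
    have "fps_nth (exp_bracket s g) (Suc n) - ?R =
        (1 - of_nat n) * (fps_nth s n - fps_nth ?s n) * fps_nth g 1"
      using adm assms(1) n by (intro exp_bracket_change) (auto simp: admissible_def s_def)
    also have "fps_nth s n - fps_nth ?s n = smult (1 / (of_nat n - 1)) (?R div [:b, a:])"
      using n by (simp add: s_def) (subst normalizer.simps, simp add: assms(2)[unfolded One_nat_def])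
    also have "(1 - of_nat n) * smult (1 / (of_nat n - 1)) (?R div [:b, a:]) = - (?R div [:b, a:])"
    proof -
      have "(1 - of_nat n :: 'a poly) = [:1 - of_nat n:]"
        by (simp add: of_nat_poly one_pCons)
      moreover have "(1 - of_nat n) / (of_nat n - 1) = (-1 :: 'a)"
        using nz by (simp add: divide_simps)
      ultimately show ?thesis
        by simp
    qed
    finally have "fps_nth (exp_bracket s g) (Suc n) - ?R = - (?R div [:b, a:] * [:b, a:])"
      by (simp only: assms(2) mult_minus_left)
    then have "fps_nth (exp_bracket s g) (Suc n) = ?R - ?R div [:b, a:] * [:b, a:]"
      by (simp only: diff_eq_eq) (simp only: add.commute add_uminus_conv_diff)
    then have "fps_nth (exp_bracket s g) (Suc n) = ?R mod [:b, a:]"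
      by (simp only: minus_div_mult_eq_mod)
    moreover have "degree (?R mod [:b, a:]) = 0"
      using degree_mod_less'[of "[:b, a:]" ?R] assms(3) by (cases "?R mod [:b, a:] = 0") auto
    ultimately show ?thesis
      by simp
  qed
  from this[of "_ - 1"] show "degree (fps_nth (exp_bracket s g) n) = 0" if "3 \<le> n" for n
    using that by (cases n) auto
qed

lemma on_line_exp_bracket:
  "poly (fps_nth (exp_bracket s g) k) t =
    (\<Sum>m\<le>k. fps_nth ((bracket (on_line t s) ^^ m) (on_line t g)) k / fact m)"
  by (simp add: exp_bracket_def poly_sum flip: on_line_bracket_iter)

text \<open>On the line, only the first bracket of the exponential series reaches the degree \<open>r + 1\<close>, so the
  coefficient there depends affinely on the linear part of \<open>s\<close>, and not on its other parts.\<close>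

lemma on_line_exp_bracket_leading:
  assumes "line_order t r g" "fps_nth s 0 = 0"
  shows "k \<le> r \<Longrightarrow> poly (fps_nth (exp_bracket s g) k) t = poly (fps_nth g k) t"
    and "poly (fps_nth (exp_bracket s g) (Suc r)) t =
      poly (fps_nth g (Suc r)) t + poly (fps_nth s 1) t * poly (fps_nth g r) t * (of_nat r - 1)"
proof -
  let ?h = "\<lambda>m. (bracket (on_line t s) ^^ m) (on_line t g)"
  have r: "2 \<le> r" and low: "\<And>k. k \<le> r - 1 \<Longrightarrow> fps_nth (on_line t g) k = 0"
    using assms(1) by (auto simp: line_order_def)
  have v: "fps_nth (?h m) k = 0" if "k < r + m" for m k
    using bracket_iter_vanishes[of "on_line t s" "r - 1" "on_line t g" k m] low r that assms(2) by simp
  show "poly (fps_nth (exp_bracket s g) k) t = poly (fps_nth g k) t" if "k \<le> r"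
  proof -
    have "(\<Sum>m\<le>k. fps_nth (?h m) k / fact m) = (\<Sum>m\<in>{0}. fps_nth (?h m) k / fact m)"
      using that by (intro sum.mono_neutral_right ballI) (auto simp: v)
    then show ?thesis
      by (simp add: on_line_exp_bracket)
  qed
  have "(\<Sum>m\<le>Suc r. fps_nth (?h m) (Suc r) / fact m) =
      (\<Sum>m\<in>{0, 1}. fps_nth (?h m) (Suc r) / fact m)"
    by (intro sum.mono_neutral_right ballI) (auto simp: v)
  then show "poly (fps_nth (exp_bracket s g) (Suc r)) t =
      poly (fps_nth g (Suc r)) t + poly (fps_nth s 1) t * poly (fps_nth g r) t * (of_nat r - 1)"
    using bracket_on_line_leading(2)[OF assms]
    by (simp add: on_line_exp_bracket flip: on_line_bracket del: sum.atMost_Suc)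
qed

text \<open>The linear part of the generator is chosen such that the coefficient in degree \<open>r + 1\<close> vanishes on
  the line. Being a multiple of \<open>\<rho>\<^sup>r\<^sup>+\<^sup>1\<close>, the part of this degree is then zero.\<close>

lemma normal_form_exists:
  fixes g :: "'a::field_char_0 poly fps"
  assumes g: "admissible g" "fps_nth g 1 = [:b, a:]" "a \<noteq> 0"
  obtains s r where "admissible s" "2 \<le> r"
    "\<And>n. 3 \<le> n \<Longrightarrow> degree (fps_nth (exp_bracket s g) n) = 0"
    "on_line (- b / a) (exp_bracket s g) = 0 \<and> 2 < r \<or>
     line_order (- b / a) r (exp_bracket s g) \<and> poly (fps_nth (exp_bracket s g) (Suc r)) (- b / a) = 0"
proof (cases "on_line (- b / a) g = 0")
  case True
  obtain s where s: "admissible s" "\<And>n. 3 \<le> n \<Longrightarrow> degree (fps_nth (exp_bracket s g) n) = 0"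
    by (rule normalizing_generator[OF g, of 0]) blast
  have "(bracket (on_line (- b / a) s) ^^ m) 0 = 0" for m
    by (induction m) (auto simp: bracket_linear)
  then have "on_line (- b / a) (exp_bracket s g) = 0"
    by (intro fps_ext, simp only: on_line_nth on_line_exp_bracket True) simp
  \<comment> \<open>there is no order on the line, and every \<open>r > 2\<close> would do\<close>
  with s show thesis
    by (intro that[of s 3]) auto
next
  case False
  let ?t = "- b / a"
  define r where "r = subdegree (on_line ?t g)"
  have r: "poly (fps_nth g r) ?t \<noteq> 0"
    using nth_subdegree_nonzero[OF False] unfolding r_def on_line_nth .
  have low: "poly (fps_nth g k) ?t = 0" if "k < r" for k
    using nth_less_subdegree_zero[of k "on_line ?t g"] that unfolding r_def on_line_nth .
  have "poly (fps_nth g 0) ?t = 0" "poly (fps_nth g 1) ?t = 0"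
    using g by (auto simp: admissible_def)
  then have "r \<noteq> 0 \<and> r \<noteq> 1"
    using r by metis
  then have "2 \<le> r"
    by linarith
  then have gen: "line_order ?t r g"
    using r low by (simp add: line_order_def)
  let ?c = "- poly (fps_nth g (Suc r)) ?t / (poly (fps_nth g r) ?t * (of_nat r - 1))"
  obtain s where s: "admissible s" "fps_nth s 1 = [:?c:]"
      "\<And>n. 3 \<le> n \<Longrightarrow> degree (fps_nth (exp_bracket s g) n) = 0"
    by (rule normalizing_generator[OF g, of ?c]) blast
  have s0: "fps_nth s 0 = 0"
    using s(1) by (simp add: admissible_def)
  have "line_order ?t r (exp_bracket s g)"
    using on_line_exp_bracket_leading(1)[OF gen s0] gen unfolding line_order_def by auto
  moreover have "poly (fps_nth (exp_bracket s g) (Suc r)) ?t = 0"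
  proof -
    have "?c * (poly (fps_nth g r) ?t * (of_nat r - 1)) = - poly (fps_nth g (Suc r)) ?t"
      using line_order_factor[OF gen] r by (intro nonzero_eq_divide_eq[THEN iffD1] refl) simp
    then show ?thesis
      unfolding on_line_exp_bracket_leading(2)[OF gen s0] s(2) by (simp only: mult.assoc) simp
  qed
  ultimately show thesis
    using s \<open>2 \<le> r\<close> by (intro that[of s r]) auto
qed


section \<open>Grade parts and level maps\<close>

text \<open>By homogeneity, the \<open>n\<close>-th term of any decomposition consists of the terms of total degree \<open>n + 1\<close>,
  so there is only one decomposition.\<close>

lemma grade_part_eq:
  fixes g :: "'a::field_char_0 poly fps"
  assumes "admissible g"
  shows "grade_part (Theta + field_of g) = (\<lambda>n. if n = 0 then Theta else graded g n)"
proof -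
  let ?v = "Theta + field_of g" and ?u = "\<lambda>n. if n = 0 then Theta else graded g n"
  have g0: "graded g 0 = 0"
    using assms by (simp add: graded_def admissible_def)
  have Theta: "degrees_in {Suc 0} (Theta :: 'a vfield)"
    using degrees_in_Theta by simp
  have sp: "degrees_in {Suc 0} V" if "V \<in> vf_span {Theta}" for V :: "'a vfield"
    using that Theta unfolding vf.span_singleton by (auto intro: degrees_in_smul)
  have deg: "degrees_in {Suc n} (u n)" if "is_decomp w u" for w and u :: "nat \<Rightarrow> 'a vfield" and n
  proof (cases "n = 0")
    case False
    then show ?thesis
      using that by (intro degrees_in_E_space) (auto simp: is_decomp_def)
  qed (use that sp in \<open>auto simp: is_decomp_def\<close>)
  have c: "coeff3 (u n $ j) a b c = (if a + b + c = Suc n then coeff3 (w $ j) a b c else 0)"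
    if "is_decomp w u" for w and u :: "nat \<Rightarrow> 'a vfield" and n j a b c
  proof -
    have w: "w = formal_sum u UNIV"
      using that by (simp add: is_decomp_def)
    have "coeff3 (u n $ j) a b c = 0" if "a + b + c \<noteq> Suc n"
      using deg[OF \<open>is_decomp w u\<close>, of n] that unfolding degrees_in_def by blast
    then show ?thesis
      using deg[OF that] unfolding w by (subst coeff3_formal_sum_graded) auto
  qed
  have "?u 0 \<in> vf_span {Theta}"
    by (simp add: vf.span_base)
  moreover have "?v = formal_sum ?u UNIV"
  proof (rule vfield_eqI)
    fix j and a b c :: nat
    have "coeff3 (Theta $ j :: 'a fps3) a b c = 0" if "a + b + c \<noteq> 1"
      using Theta that by (auto simp: degrees_in_def)
    then show "coeff3 (?v $ j) a b c = coeff3 (formal_sum ?u UNIV $ j) a b c"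
      using Theta degrees_in_graded[of _ g]
      by (subst coeff3_formal_sum_graded) (auto simp: coeff3_field_of g0 split: if_splits)
  qed
  ultimately have "is_decomp ?v ?u"
    by (auto simp: is_decomp_def graded_in_E_space)
  moreover have "u = ?u" if "is_decomp ?v u" for u
    using c[OF that] c[OF \<open>is_decomp ?v ?u\<close>] by (intro ext vfield_eqI) metis
  ultimately show ?thesis
    unfolding grade_part_def by (rule the_equality)
qed

text \<open>The recursion unfolds as follows. Extended by zero from \<open>{n - k<..n}\<close>, the function \<open>Y\<close>
  gives a generator whose bracket with \<open>v\<close> vanishes in all grades below \<open>n\<close>: for the grade \<open>m\<close>
  only the \<open>m - (n - k)\<close> values of \<open>Y\<close> with indices in \<open>{n - k<..m}\<close> matter.\<close>

lemma level_domD: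
  assumes "Y \<in> level_dom v n k" "k \<le> n"
  shows "n - k < m \<Longrightarrow> m \<le> n \<Longrightarrow> Y m \<in> E_space m"
    and "n - k < m \<Longrightarrow> m < n \<Longrightarrow> level_map v m (m - (n - k)) Y = 0"
proof -
  have "(\<forall>m. n - k < m \<and> m \<le> n \<longrightarrow> Y m \<in> E_space m) \<and>
      (\<forall>m. n - k < m \<and> m < n \<longrightarrow> level_map v m (m - (n - k)) Y = 0)"
    using assms
  proof (induction k arbitrary: n)
    case (Suc k)
    then obtain n' where n: "n = Suc n'"
      by (cases n) auto
    have Y: "Y n \<in> E_space n" "Y \<in> level_dom v n' k" "level_map v n' k Y = 0"
      using Suc.prems(1) by (auto simp: n)
    have k: "k \<le> n'"
      using Suc.prems(2) n by simp
    note IH = Suc.IH[OF Y(2) k]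
    show ?case
    proof (intro conjI allI impI; elim conjE)
      fix m assume "n - Suc k < m" "m \<le> n"
      then show "Y m \<in> E_space m"
        using IH Y(1) n by (cases "m = n") auto
    next
      fix m assume m: "n - Suc k < m" "m < n"
      then show "level_map v m (m - (n - Suc k)) Y = 0"
        using IH Y(3) n k by (cases "m = n'") auto
    qed
  qed auto
  then show "n - k < m \<Longrightarrow> m \<le> n \<Longrightarrow> Y m \<in> E_space m"
    and "n - k < m \<Longrightarrow> m < n \<Longrightarrow> level_map v m (m - (n - k)) Y = 0"
    by auto
qed

text \<open>The level map computes the grade \<open>m\<close> of a Lie bracket with \<open>v\<close>, since grades add up and the
  terms of grade \<open>m\<close> are those of total degree \<open>m + 1\<close>.\<close>

lemma lie_sum_graded_part:
  fixes g :: "'a::field_char_0 poly fps"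
  assumes g: "admissible g" and v: "v = Theta + field_of g"
    and Y: "\<And>j. j \<in> {d<..n} \<Longrightarrow> Y j \<in> E_space j"
    and m: "m \<le> n" "a + b + c = Suc m"
  shows "coeff3 (lie (\<Sum>j\<in>{d<..n}. Y j) v $ i) a b c = coeff3 (level_map v m (m - d) Y $ i) a b c"
proof -
  let ?u = "grade_part v"
  define w where "w = v - (\<Sum>e\<le>m. ?u e)"
  have u: "?u = (\<lambda>n. if n = 0 then Theta else graded g n)"
    unfolding v by (rule grade_part_eq[OF g])
  have deg_u: "degrees_in {Suc e} (?u e)" for e
    using degrees_in_Theta degrees_in_graded[of e g] by (auto simp: u)
  have deg_w: "degrees_in {n. Suc m < n} w"
    unfolding degrees_in_def
  proof (intro allI impI)
    fix j and a b c :: nat assume nz: "coeff3 (w $ j) a b c \<noteq> 0"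
    show "a + b + c \<in> {n. Suc m < n}"
    proof (rule ccontr)
      assume *: "a + b + c \<notin> {n. Suc m < n}"
      have t: "coeff3 (Theta $ j :: 'a fps3) a b c = 0" if "a + b + c \<noteq> 1"
        using degrees_in_Theta that unfolding degrees_in_def by blast
      have z: "coeff3 (?u e $ j) a b c = 0" if "a + b + c \<noteq> Suc e" for e
        using deg_u[of e] that unfolding degrees_in_def by blast
      have g0: "graded g 0 = 0"
        using g by (simp add: graded_def admissible_def)
      show False
      proof (cases "a + b + c")
        case 0
        then have "coeff3 (v $ j) a b c = 0"
          using t by (simp add: v coeff3_field_of)
        then show False
          using nz z 0 by (simp add: w_def coeff3_sum)
      next
        case (Suc e)
        then have "(\<Sum>e\<le>m. coeff3 (?u e $ j) a b c) = (\<Sum>e'\<in>{e}. coeff3 (?u e' $ j) a b c)"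
          using z * by (intro sum.mono_neutral_right) auto
        also have "\<dots> = coeff3 (v $ j) a b c"
          using Suc t g0 by (simp add: u) (auto simp: v coeff3_field_of)
        finally show False
          using nz by (simp add: w_def coeff3_sum)
      qed
    qed
  qed
  have summand: "coeff3 (lie (Y j) v $ i) a b c =
      (if j \<le> m then coeff3 (lie (Y j) (?u (m - j)) $ i) a b c else 0)" if j: "j \<in> {d<..n}" for j
  proof -
    have Yj: "degrees_in {Suc j} (Y j)"
      using degrees_in_E_space[OF Y[OF j]] .
    have "degrees_in {n. Suc m < n} (lie (Y j) w)"
      by (rule degrees_in_mono[OF degrees_in_lie[OF Yj deg_w]]) auto
    then have "coeff3 (lie (Y j) w $ i) a b c = 0"
      using m(2) unfolding degrees_in_def by (metis less_irrefl mem_Collect_eq)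
    moreover have "lie (Y j) ((\<Sum>e\<le>m. ?u e) + w) = (\<Sum>e\<le>m. lie (Y j) (?u e)) + lie (Y j) w"
      by (simp only: lie_linear lie_sum)
    then have "lie (Y j) v = (\<Sum>e\<le>m. lie (Y j) (?u e)) + lie (Y j) w"
      by (simp add: w_def)
    ultimately have "coeff3 (lie (Y j) v $ i) a b c = (\<Sum>e\<le>m. coeff3 (lie (Y j) (?u e) $ i) a b c)"
      by (simp add: coeff3_sum)
    also have "\<dots> = (\<Sum>e\<in>(if j \<le> m then {m - j} else {}). coeff3 (lie (Y j) (?u e) $ i) a b c)"
    proof (intro sum.mono_neutral_right ballI)
      fix e assume e: "e \<in> {..m} - (if j \<le> m then {m - j} else {})"
      have "degrees_in {Suc (j + e)} (lie (Y j) (?u e))"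
        by (rule degrees_in_mono[OF degrees_in_lie[OF Yj deg_u]]) auto
      moreover have "a + b + c \<noteq> Suc (j + e)"
        using e m(2) by (auto split: if_splits)
      ultimately show "coeff3 (lie (Y j) (?u e) $ i) a b c = 0"
        unfolding degrees_in_def by blast
    qed auto
    finally show ?thesis
      by simp
  qed
  have "coeff3 (lie (\<Sum>j\<in>{d<..n}. Y j) v $ i) a b c =
      (\<Sum>j\<in>{d<..n}. if j \<le> m then coeff3 (lie (Y j) (?u (m - j)) $ i) a b c else 0)"
    unfolding lie_sum sum_component coeff3_sum by (intro sum.cong refl summand)
  also have "\<dots> = (\<Sum>j\<in>{d<..m}. coeff3 (lie (Y j) (?u (m - j)) $ i) a b c)"
    using m(1) by (intro sum.mono_neutral_cong_right) auto
  also have "\<dots> = (\<Sum>e<m - d. coeff3 (lie (Y (m - e)) (?u e) $ i) a b c)"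
    by (rule sum.reindex_bij_witness[of _ "\<lambda>e. m - e" "\<lambda>j. m - j"]) auto
  finally show ?thesis
    by (simp add: level_map_def coeff3_sum)
qed

text \<open>A grade part of \<open>v\<close> in the image of a level map is the leading part, with respect to the grade,
  of a bracket with \<open>v\<close>. This holds for every level \<open>k\<close> alike, so all levels are treated at
  once below.\<close>

lemma level_im_series:
  fixes g :: "'a::field_char_0 poly fps"
  assumes g: "admissible g" and v: "v = Theta + field_of g"
    and k: "1 \<le> k" "k \<le> n" and im: "graded g n \<in> level_im v n k"
  obtains f where "admissible f"
    "\<And>j l. l \<le> j \<Longrightarrow> 2 * j - l < n \<Longrightarrow> coeff (fps_nth (bracket f g) j) l = 0"
    "\<And>j l. l \<le> j \<Longrightarrow> 2 * j - l = n \<Longrightarrow> coeff (fps_nth (bracket f g) j) l = coeff (fps_nth g j) l"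
proof -
  obtain Y where Y: "Y \<in> level_dom v n k" and V: "level_map v n k Y = graded g n"
    using im unfolding level_im_def by auto
  let ?d = "n - k"
  let ?S = "\<Sum>j\<in>{?d<..n}. Y j"
  have Yj: "Y j \<in> E_space j" if "j \<in> {?d<..n}" for j
    using level_domD(1)[OF Y k(2)] that by simp
  have "?S \<in> field_of ` {f. admissible f}"
    by (rule vf.subspace_sum[OF subspace_field_of]) (metis E_space_field_of Yj image_eqI mem_Collect_eq)
  then obtain f where f: "admissible f" "?S = field_of f"
    by auto
  let ?B = "bracket f g"
  have B: "admissible ?B"
    by (rule admissible_bracket[OF f(1) g])
  have lie: "lie ?S v = field_of ?B"
    by (simp add: f v lie_linear lie_field_of_Theta lie_field_of g)
  have co: "coeff3 (field_of ?B $ 1) a b c = coeff3 (level_map v m (m - ?d) Y $ 1) a b c"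
    if "m \<le> n" "a + b + c = Suc m" for a b c m
    using lie_sum_graded_part[where d = ?d and i = 1, OF g v Yj that] by (simp add: lie)
  have idx: "(l + 1) + 2 * (j - l) + 0 = Suc (2 * j - l)" if "l \<le> j" for j l :: nat
    using that by linarith
  have sym: "coeff (fps_nth h j) l = coeff3 (field_of h $ 1) (l + 1) (2 * (j - l)) 0"
    if "admissible h" "l \<le> j" "0 < j" for h :: "'a poly fps" and j l
    using coeff_symbol[of "field_of h" j l] that by (simp add: symbol_field_of)
  show thesis
  proof (rule that[OF f(1)])
    fix j l :: nat assume jl: "l \<le> j" "2 * j - l < n"
    show "coeff (fps_nth ?B j) l = 0"
    proof (cases "j = 0")
      case True
      then show ?thesis using B by (simp add: admissible_def)
    next
      case False
      have "level_map v (2 * j - l) (2 * j - l - ?d) Y = 0"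
      proof (cases "?d < 2 * j - l")
        case True
        then show ?thesis by (rule level_domD(2)[OF Y k(2)]) (rule jl(2))
      qed (simp add: level_map_def)
      then show ?thesis
        using False jl co[OF _ idx[OF jl(1)]] sym[OF B jl(1)] by simp
    qed
  next
    fix j l :: nat assume jl: "l \<le> j" "2 * j - l = n"
    have j: "0 < j"
      using jl k by linarith
    have "coeff (fps_nth ?B j) l = coeff3 (level_map v n (n - ?d) Y $ 1) (l + 1) (2 * (j - l)) 0"
      using j jl co[OF _ idx[OF jl(1)]] sym[OF B jl(1)] by simp
    also have "n - ?d = k"
      using k by simp
    also have "coeff3 (level_map v n k Y $ 1) (l + 1) (2 * (j - l)) 0 =
        coeff3 (field_of g $ 1) (l + 1) (2 * (j - l)) 0"
      unfolding V coeff3_field_of idx[OF jl(1)] by (simp add: jl(2))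
    also have "\<dots> = coeff (fps_nth g j) l"
      by (rule sym[OF g jl(1) j, symmetric])
    finally show "coeff (fps_nth ?B j) l = coeff (fps_nth g j) l" .
  qed
qed

text \<open>The terms of degree at most two are not removable, as brackets begin in degree three. All
  other terms are multiples \<open>\<kappa> \<rho>\<^sup>j\<close> in grade \<open>2 j\<close>. A monomial of smaller degree than \<open>j\<close>, or another
  one of degree \<open>j\<close>, has smaller grade; so leading grade \<open>2 j\<close> with leading part \<open>\<kappa> \<rho>\<^sup>j\<close> means
  leading degree \<open>j\<close> with the same leading part. By \<open>bracket_pure_leading\<close> this happens for \<open>j = r + 1\<close>
  only, where the normal form has no term.\<close>

lemma normal_form_not_removable:
  fixes g :: "'a::field_char_0 poly fps"
  assumes g: "admissible g" "fps_nth g 1 = [:b, a:]" "a \<noteq> 0"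
    and pure: "\<And>n. 3 \<le> n \<Longrightarrow> degree (fps_nth g n) = 0"
    and gen: "on_line (- b / a) g = 0 \<or>
      line_order (- b / a) r g \<and> poly (fps_nth g (Suc r)) (- b / a) = 0"
    and k: "1 \<le> k" "k \<le> n" and im: "graded g n \<in> level_im (Theta + field_of g) n k"
  shows "graded g n = 0"
proof -
  obtain f where f: "admissible f"
    and low: "\<And>j l. l \<le> j \<Longrightarrow> 2 * j - l < n \<Longrightarrow> coeff (fps_nth (bracket f g) j) l = 0"
    and eq: "\<And>j l. l \<le> j \<Longrightarrow> 2 * j - l = n \<Longrightarrow> coeff (fps_nth (bracket f g) j) l = coeff (fps_nth g j) l"
    using level_im_series[OF g(1) refl k im] by blast
  have f0: "fps_nth f 0 = 0" and g0: "fps_nth g 0 = 0"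
    using f g(1) by (auto simp: admissible_def)
  have B: "admissible (bracket f g)"
    by (rule admissible_bracket[OF f g(1)])
  have small: "fps_nth (bracket f g) j = 0" if "j \<le> 2" for j
    using bracket_leading_left(1)[of g 1 f j, OF g0] bracket_leading_left(2)[of g 1 f, OF g0] f0 that
    by (cases "j \<le> 1") (auto simp: le_Suc_eq numeral_2_eq_2)
  have "coeff (fps_nth g j) (2 * j - n) = 0" if j: "j \<le> n" "n \<le> 2 * j" for j
  proof (cases "j \<le> 2 \<or> 2 * j \<noteq> n")
    case True
    then show ?thesis
    proof
      assume "j \<le> 2"
      then show ?thesis
        using small[of j] eq[of "2 * j - n" j] j by simp
    next
      assume "2 * j \<noteq> n"
      show ?thesis
      proof (cases "j \<le> 2")
        case True
        then show ?thesis
          using small[of j] eq[of "2 * j - n" j] j by simp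
      next
        case False
        then show ?thesis
          using pure[of j] j \<open>2 * j \<noteq> n\<close> by (intro coeff_eq_0) simp
      qed
    qed
  next
    case False
    then have j3: "3 \<le> j" and n: "n = 2 * j"
      by auto
    show ?thesis
    proof (rule ccontr)
      assume nz: "coeff (fps_nth g j) (2 * j - n) \<noteq> 0"
      have zero: "fps_nth (bracket f g) i = 0" if "i < j" for i
      proof (rule poly_eqI)
        fix l
        show "coeff (fps_nth (bracket f g) i) l = coeff 0 l"
          using low[of l i] admissibleD(2)[OF B, of i l] that n by (cases "l \<le> i") auto
      qed
      have "fps_nth (bracket f g) j = [:coeff (fps_nth g j) 0:]"
      proof (rule poly_eqI)
        fix l
        show "coeff (fps_nth (bracket f g) j) l = coeff [:coeff (fps_nth g j) 0:] l"
          using low[of l j] eq[of l j] admissibleD(2)[OF B, of j l] n j3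
          by (cases "l \<le> j"; cases l) auto
      qed
      then have lead: "poly (fps_nth (bracket f g) j) (- b / a) \<noteq> 0"
        using nz n by simp
      have "on_line (- b / a) g = 0 \<or> line_order (- b / a) r g"
        using gen by blast
      from bracket_pure_leading[OF g0 g(2,3) this f zero lead]
      have gr: "line_order (- b / a) r g" "j = Suc r"
        by auto
      then have "on_line (- b / a) g \<noteq> 0"
        by (auto simp: line_order_def fps_eq_iff)
      then have "poly (fps_nth g j) (- b / a) = 0"
        using gen gr by blast
      moreover obtain d where "fps_nth g j = [:d:]"
        using pure[OF j3] by (rule degree_eq_zeroE)
      ultimately show False
        using nz n by simp
    qed
  qed
  then show ?thesis
    by (simp add: graded_def)
qed

lemma lie_E_space:
  assumes "V \<in> E_space p" "W \<in> E_space q" "1 \<le> p + q"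
  shows "lie V W \<in> E_space (p + q)"
proof -
  obtain f where f: "admissible f" "V = field_of f"
    using E_space_field_of[OF assms(1)] by metis
  obtain g where g: "admissible g" "W = field_of g"
    using E_space_field_of[OF assms(2)] by metis
  let ?h = "bracket f g"
  have "degrees_in {Suc (p + q)} (lie V W)"
    by (rule degrees_in_mono[OF degrees_in_lie[OF degrees_in_E_space[OF assms(1)]
        degrees_in_E_space[OF assms(2)]]]) auto
  moreover have h: "lie V W = field_of ?h"
    by (simp add: f g lie_field_of)
  ultimately have deg: "degrees_in {Suc (p + q)} (field_of ?h)"
    by simp
  have "field_of ?h = graded ?h (p + q)"
  proof (rule vfield_eqI)
    fix j and a b c :: nat
    show "coeff3 (field_of ?h $ j) a b c = coeff3 (graded ?h (p + q) $ j) a b c"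
    proof (cases "a + b + c = Suc (p + q)")
      case False
      then have "coeff3 (field_of ?h $ j) a b c = 0" "coeff3 (graded ?h (p + q) $ j) a b c = 0"
        using deg degrees_in_graded[of "p + q" ?h] unfolding degrees_in_def by blast+
      then show ?thesis
        by simp
    qed (simp add: coeff3_field_of)
  qed
  then show ?thesis
    using graded_in_E_space[OF assms(3)] by (simp add: h)
qed

lemma level_map_linear:
  "level_map v n k (\<lambda>i. Y i + Z i) = level_map v n k Y + level_map v n k Z"
  "level_map v n k (\<lambda>i. smul s (Y i)) = smul s (level_map v n k Y)"
  "level_map v n k (\<lambda>i. 0) = 0"
  by (simp_all add: level_map_def lie_linear sum.distrib vf.scale_sum_right)

lemma E_space_closed:
  "0 \<in> E_space n" "V \<in> E_space n \<Longrightarrow> W \<in> E_space n \<Longrightarrow> V + W \<in> E_space n"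
  "V \<in> E_space n \<Longrightarrow> smul s V \<in> E_space n"
  by (simp_all add: E_space_def vf.span_zero vf.span_add vf.span_scale)

lemma level_dom_closed:
  "(\<lambda>i. 0) \<in> level_dom v n k"
  "Y \<in> level_dom v n k \<Longrightarrow> Z \<in> level_dom v n k \<Longrightarrow> (\<lambda>i. Y i + Z i) \<in> level_dom v n k"
  "Y \<in> level_dom v n k \<Longrightarrow> (\<lambda>i. smul s (Y i)) \<in> level_dom v n k"
  by (induction k arbitrary: n) (auto simp: level_map_linear E_space_closed)


section \<open>Normal form styles\<close>

lemma subspace_level_im: "vf.subspace (level_im v n k)"
  unfolding vf.subspace_def level_im_def
proof (intro conjI ballI allI)
  show "0 \<in> level_map v n k ` level_dom v n k"
    using level_dom_closed(1) level_map_linear(3) by (metis imageI)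
  fix V assume "V \<in> level_map v n k ` level_dom v n k"
  then obtain Y where Y: "Y \<in> level_dom v n k" "V = level_map v n k Y"
    by blast
  show "smul s V \<in> level_map v n k ` level_dom v n k" for s
    unfolding Y(2) level_map_linear(2)[symmetric] using level_dom_closed(3)[OF Y(1)] by blast
  fix W assume "W \<in> level_map v n k ` level_dom v n k"
  then obtain Z where Z: "Z \<in> level_dom v n k" "W = level_map v n k Z"
    by blast
  show "V + W \<in> level_map v n k ` level_dom v n k"
    unfolding Y(2) Z(2) level_map_linear(1)[symmetric] using level_dom_closed(2)[OF Y(1) Z(1)] by blast
qed

lemma level_im_subset:
  fixes g :: "'a::field_char_0 poly fps"
  assumes g: "admissible g" and v: "v = Theta + field_of g" and k: "1 \<le> k" "k \<le> n"
  shows "level_im v n k \<subseteq> E_space n"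
proof
  fix V assume "V \<in> level_im v n k"
  then obtain Y where Y: "Y \<in> level_dom v n k" and V: "V = level_map v n k Y"
    unfolding level_im_def by blast
  have u: "grade_part v = (\<lambda>n. if n = 0 then Theta else graded g n)"
    unfolding v by (rule grade_part_eq[OF g])
  have "lie (Y (n - i)) (grade_part v i) \<in> E_space n" if i: "i < k" for i
  proof -
    have Yi: "Y (n - i) \<in> E_space (n - i)"
      using level_domD(1)[OF Y k(2), of "n - i"] i k by simp
    show ?thesis
    proof (cases "i = 0")
      case True
      have "lie (Y (n - i)) Theta = 0"
        using E_space_field_of[OF Yi] lie_field_of_Theta by metis
      then show ?thesis
        using True by (simp add: u E_space_closed)
    next
      case False
      then show ?thesis
        using lie_E_space[OF Yi graded_in_E_space[of i g]] i k by (simp add: u)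
    qed
  qed
  then show "V \<in> E_space n"
    unfolding V level_map_def E_space_def by (intro vf.span_sum) auto
qed

text \<open>Extend a basis of \<open>W\<close> first by \<open>w\<close> and then to a basis of \<open>U\<close>; the new basis vectors span the
  complement.\<close>

lemma complement_containing:
  fixes U W :: "'a::field_char_0 vfield set"
  assumes "vf.subspace U" "vf.subspace W" "W \<subseteq> U" "w \<in> U" "w \<in> W \<Longrightarrow> w = 0"
  obtains C where "is_complement C W U" "w \<in> C"
proof -
  obtain B where B: "B \<subseteq> W" "vf.independent B" "W \<subseteq> vf.span B"
    using vf.maximal_independent_subset by metis
  then have spB: "vf.span B = W"
    using assms(2) vf.span_minimal by (metis subset_antisym)
  \<comment> \<open>the zero vector lies in every complement, but not in a basis\<close>
  define B1 where "B1 = (if w = 0 then B else insert w B)"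
  have B1: "vf.independent B1" "B1 \<subseteq> U" "B \<subseteq> B1"
    using B assms spB vf.independent_insertI[of w B] by (auto simp: B1_def)
  obtain B2 where B2: "B1 \<subseteq> B2" "B2 \<subseteq> U" "vf.independent B2" "U \<subseteq> vf.span B2"
    using vf.maximal_independent_subset_extend[OF B1(2,1)] by metis
  let ?C = "vf.span (B2 - B)"
  have un: "B2 = (B2 - B) \<union> B"
    using B1 B2 by auto
  have spB2: "vf.span B2 = U"
    using B2 assms(1) vf.span_minimal by (metis subset_antisym)
  have "U = {c + w | c w. c \<in> ?C \<and> w \<in> W}"
    using spB2 un vf.span_Un[of "B2 - B" B] spB by simp
  moreover have "?C \<inter> W = {0}"
  proof (intro equalityI subsetI)
    fix x assume "x \<in> ?C \<inter> W"
    then have x: "x \<in> ?C" "x \<in> vf.span B"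
      using spB by auto
    have "vf.representation B2 x = vf.representation (B2 - B) x"
      by (rule vf.representation_extend[OF B2(3) x(1)]) auto
    moreover have "vf.representation B2 x = vf.representation B x"
      using un by (intro vf.representation_extend[OF B2(3) x(2)]) auto
    ultimately have "vf.representation B2 x b = 0" for b
      using vf.representation_ne_zero[of "B2 - B" x b] vf.representation_ne_zero[of B x b] by auto
    moreover have "x \<in> vf.span B2"
      using x(1) vf.span_mono[of "B2 - B" B2] by auto
    ultimately show "x \<in> {0}"
      using vf.sum_nonzero_representation_eq[OF B2(3), of x] by simp
  qed (use assms(2) vf.span_zero vf.subspace_0 in auto)
  moreover have "?C \<subseteq> U"
    using spB2 vf.span_mono[of "B2 - B" B2] by auto
  ultimately have "is_complement ?C W U"
    by (auto simp: is_complement_def)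
  moreover have "w \<in> ?C"
  proof (cases "w = 0")
    case False
    then have "w \<in> B2 - B"
      using B2(1) B(1) assms(5) by (auto simp: B1_def)
    then show ?thesis
      by (rule vf.span_base)
  qed (simp add: vf.span_zero)
  ultimately show thesis
    by (rule that)
qed

text \<open>The complements for different grades and levels are independent of each other, so one by one
  they can be made to contain the grade parts of \<open>v\<close>.\<close>

lemma normal_form_style_exists:
  fixes g :: "'a::field_char_0 poly fps"
  assumes g: "admissible g" and v: "v = Theta + field_of g"
    and nr: "\<And>n k. 1 \<le> k \<Longrightarrow> k \<le> n \<Longrightarrow> graded g n \<in> level_im v n k \<Longrightarrow> graded g n = 0"
  obtains C where "infinite_normal_form C v" "\<And>k. 1 \<le> k \<Longrightarrow> level_normal_form C k v"
proof -
  have u: "grade_part v n = graded g n" if "1 \<le> n" for n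
    unfolding v grade_part_eq[OF g] using that by simp
  have "\<forall>n k. \<exists>D. 1 \<le> k \<and> k \<le> n \<longrightarrow> is_complement D (level_im v n k) (E_space n) \<and> grade_part v n \<in> D"
  proof (intro allI)
    fix n k
    show "\<exists>D. 1 \<le> k \<and> k \<le> n \<longrightarrow> is_complement D (level_im v n k) (E_space n) \<and> grade_part v n \<in> D"
    proof (cases "1 \<le> k \<and> k \<le> n")
      case True
      have "vf.subspace (E_space n :: 'a vfield set)"
        by (simp add: E_space_def)
      moreover have "grade_part v n \<in> E_space n"
          "grade_part v n \<in> level_im v n k \<Longrightarrow> grade_part v n = 0"
        using True u[of n] graded_in_E_space[of n g] nr[of k n] by auto
      ultimately obtain D where "is_complement D (level_im v n k) (E_space n)" "grade_part v n \<in> D"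
        using complement_containing[OF _ subspace_level_im level_im_subset[OF g v]] True by blast
      then show ?thesis
        by blast
    qed auto
  qed
  then obtain C where C: "\<And>n k. 1 \<le> k \<Longrightarrow> k \<le> n \<Longrightarrow>
      is_complement (C n k) (level_im v n k) (E_space n) \<and> grade_part v n \<in> C n k"
    by metis
  show thesis
    by (rule that[of C]) (use C in \<open>auto simp: infinite_normal_form_def level_normal_form_def normal_form_style_def\<close>)
qed


section \<open>Symmetries\<close>

text \<open>A symmetry is the exponential of some generator \<open>s\<close>, and \<open>exp_bracket_fixed\<close> shows that \<open>s\<close> itself
  commutes with the vector field.\<close>

lemma symmetries_trivial:
  fixes g :: "'a::field_char_0 poly fps"
  assumes g: "admissible g" "fps_nth g 1 = [:b, a:]" "a \<noteq> 0" and gen: "line_order (- b / a) r g"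
    and \<psi>: "\<psi> \<in> symmetry_group (Theta + field_of g)"
  shows "trivial_symmetry (Theta + field_of g) \<psi>"
proof -
  obtain s where s: "admissible s" "\<psi> = exp_ad (field_of s)"
    using \<psi> by (auto simp: symmetry_group_def permissible_def generators_eq)
  have "Theta + field_of (exp_bracket s g) = Theta + field_of g"
    using \<psi> exp_ad_field_of[OF s(1) g(1)] by (simp add: s(2) symmetry_group_def)
  then have "exp_bracket s g = g"
    using symbol_field_of[OF g(1)] symbol_field_of[OF admissible_exp_bracket[OF s(1) g(1)]] by simp
  then have "bracket s g = 0"
    using s(1) g(1) by (intro exp_bracket_fixed) (auto simp: admissible_def)
  moreover have "fps_nth g 0 = 0"
    using g(1) by (simp add: admissible_def)
  ultimately obtain c where "s = fps_const [:c:] * g"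
    using commuting_is_multiple[OF _ g(2,3) gen s(1)] by metis
  then show ?thesis
    unfolding trivial_symmetry_def by (auto simp: s(2) field_of_linear)
qed


section \<open>The normal form theorem\<close>

lemma formal_sum_rho_powers:
  "formal_sum (\<lambda>k. smul (c k) (E 0 k)) I = field_of (Abs_fps (\<lambda>k. if k \<in> I then [:c k:] else 0))"
    (is "_ = field_of ?f")
proof (rule vfield_eqI)
  fix j and a b d :: nat
  have deg: "coeff3 (E 0 k $ j :: 'a fps3) a b d = 0" if "a + b + d \<noteq> Suc (2 * k)" for k
    using degrees_in_E[of 0 k, where 'a='a] that by (auto simp: degrees_in_def E_grade_def)
  let ?J = "{k \<in> I. a + b + d = Suc (2 * k)}"
  have "finite ?J"
    by (rule finite_subset[of _ "{..a + b + d}"]) auto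
  then have "coeff3 (formal_sum (\<lambda>k. smul (c k) (E 0 k)) I $ j) a b d =
      (\<Sum>k\<in>?J. c k * coeff3 (E 0 k $ j) a b d)"
    by (subst coeff3_formal_sum[of ?J]) (auto simp: deg)
  also have "\<dots> = coeff3 (field_of ?f $ j) a b d"
  proof (cases "a + b + d")
    case (Suc n)
    have "coeff3 (field_of ?f $ j) a b d = (\<Sum>k | k \<le> n \<and> n \<le> 2 * k.
        coeff (fps_nth ?f k) (2 * k - n) * coeff3 (E (2 * k - n) k $ j) a b d)"
      using Suc by (simp add: coeff3_field_of graded_def coeff3_sum)
    also have "\<dots> = (\<Sum>k\<in>?J. c k * coeff3 (E 0 k $ j) a b d)"
    proof (rule sum.mono_neutral_cong_right)
      show "finite {k. k \<le> n \<and> n \<le> 2 * k}"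
        by (rule finite_subset[of _ "{..n}"]) auto
    qed (use Suc in \<open>auto simp: coeff_pCons split: nat.splits\<close>)
    finally show ?thesis ..
  qed (simp add: coeff3_field_of)
  finally show "coeff3 (formal_sum (\<lambda>k. smul (c k) (E 0 k)) I $ j) a b d =
      coeff3 (field_of ?f $ j) a b d" .
qed

lemma monomial_nth: "fps_nth (monomial l k) n = (if n = k then monom 1 l else 0)"
  by (simp add: monomial_def)

lemma field_of_explicit:
  fixes f :: "'a::field_char_0 poly fps"
  assumes "f = fps_const [:c1:] * monomial 1 1 + fps_const [:c2:] * monomial 0 1
      + fps_const [:c3:] * monomial 2 2 + fps_const [:c4:] * monomial 1 2
      + h + Abs_fps (\<lambda>k. if k \<in> I then [:c k:] else 0)"
  shows "Theta + field_of f = Theta + smul c1 (E 1 1) + smul c2 (E 0 1) + smul c3 (E 2 2)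
      + smul c4 (E 1 2) + field_of h + formal_sum (\<lambda>k. smul (c k) (E 0 k)) I"
  unfolding assms by (simp add: field_of_linear field_of_monomial formal_sum_rho_powers add.assoc)

theorem theorem3p2:
  fixes \<beta> :: "nat \<Rightarrow> nat \<Rightarrow> 'a::field_char_0"
    and v2 :: "'a vfield"
  assumes "\<beta> 1 1 \<noteq> 0"
    and "v2 = Theta + smul (\<beta> 1 1) (E 1 1) + smul (\<beta> 0 1) (E 0 1)
           + smul (\<beta> 2 2) (E 2 2) + smul (\<beta> 1 2) (E 1 2)
           + formal_sum (\<lambda>k. smul (\<beta> 0 k) (E 0 k)) {2..}"
  shows "\<exists>(r::nat) \<phi> (\<gamma> :: nat \<Rightarrow> nat \<Rightarrow> 'a) v C.
           \<phi> \<in> permissible \<and> v = \<phi> v2 \<and> \<gamma> 1 1 \<noteq> 0 \<and>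
           (2 \<le> r \<and>
              v = Theta + smul (\<gamma> 1 1) (E 1 1) + smul (\<gamma> 0 1) (E 0 1)
                + smul (\<gamma> 2 2) (E 2 2) + smul (\<gamma> 1 2) (E 1 2)
                + smul (\<gamma> 0 r) (E 0 r)
                + formal_sum (\<lambda>k. smul (\<gamma> 0 k) (E 0 k)) {r+2..}
            \<or>
            2 < r \<and>
              divisible_coeff \<gamma> \<noteq> 0 \<and>
              v = Theta + smul (\<gamma> 1 1) (E 1 1) + smul (\<gamma> 0 1) (E 0 1)
                + smul (\<gamma> 2 2) (E 2 2) + smul (\<gamma> 1 2) (E 1 2)
                + smul (divisible_coeff \<gamma>) (E 0 2)
                + smul (\<gamma> 0 r) (E 0 r)
                + formal_sum (\<lambda>k. smul (\<gamma> 0 k) (E 0 k)) {r+2..}) \<and>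
           level_normal_form C (2 * r + 2) v \<and>
           infinite_normal_form C v \<and>
           (\<gamma> 0 r \<noteq> 0 \<longrightarrow> (\<forall>\<psi> \<in> symmetry_group v. trivial_symmetry v \<psi>))"
proof -
  define g where "g = Abs_fps (\<lambda>k. if k = 0 then 0 else if k = 1 then [:\<beta> 0 1, \<beta> 1 1:]
    else if k = 2 then [:\<beta> 0 2, \<beta> 1 2, \<beta> 2 2:] else [:\<beta> 0 k:])"
  have g: "admissible g" "fps_nth g 1 = [:\<beta> 0 1, \<beta> 1 1:]"
    by (auto simp: g_def admissible_def)
  have "g = fps_const [:\<beta> 1 1:] * monomial 1 1 + fps_const [:\<beta> 0 1:] * monomial 0 1
      + fps_const [:\<beta> 2 2:] * monomial 2 2 + fps_const [:\<beta> 1 2:] * monomial 1 2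
      + 0 + Abs_fps (\<lambda>k. if k \<in> {2..} then [:\<beta> 0 k:] else 0)"
    by (rule fps_ext) (simp add: g_def monomial_nth monom_altdef power2_eq_square)
  from field_of_explicit[OF this] have v2: "v2 = Theta + field_of g"
    unfolding assms(2) by simp
  obtain s r where s: "admissible s" and r: "2 \<le> r"
    and pure: "\<And>n. 3 \<le> n \<Longrightarrow> degree (fps_nth (exp_bracket s g) n) = 0"
    and gen: "on_line (- \<beta> 0 1 / \<beta> 1 1) (exp_bracket s g) = 0 \<and> 2 < r \<or>
      line_order (- \<beta> 0 1 / \<beta> 1 1) r (exp_bracket s g) \<and>
      poly (fps_nth (exp_bracket s g) (Suc r)) (- \<beta> 0 1 / \<beta> 1 1) = 0"
    using normal_form_exists[OF g assms(1)] by metis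
  define G where "G = exp_bracket s g"
  define \<gamma> where "\<gamma> = (\<lambda>l k. coeff (fps_nth G k) l)"
  define v where "v = exp_ad (field_of s) v2"
  let ?t = "- \<beta> 0 1 / \<beta> 1 1"
  have v: "v = Theta + field_of G"
    unfolding v_def v2 G_def by (rule exp_ad_field_of[OF s g(1)])
  have G: "admissible G"
    unfolding G_def by (rule admissible_exp_bracket[OF s g(1)])
  have "fps_nth G 1 = fps_nth g 1" "fps_nth G 2 = fps_nth g 2"
    unfolding G_def by (rule exp_bracket_low; use s g(1) in \<open>simp add: admissible_def\<close>)+
  then have G1: "fps_nth G 1 = [:\<beta> 0 1, \<beta> 1 1:]" and G2: "fps_nth G 2 = [:\<beta> 0 2, \<beta> 1 2, \<beta> 2 2:]"
    by (simp_all add: g_def)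
  have \<gamma>_low: "\<gamma> 1 1 = \<beta> 1 1" "\<gamma> 0 1 = \<beta> 0 1" "\<gamma> 2 2 = \<beta> 2 2" "\<gamma> 1 2 = \<beta> 1 2" "\<gamma> 0 2 = \<beta> 0 2"
    using G1 G2 by (simp_all add: \<gamma>_def numeral_2_eq_2)
  have G_high: "fps_nth G k = [:\<gamma> 0 k:]" if "3 \<le> k" for k
    using pure[OF that] unfolding G_def[symmetric] \<gamma>_def by (metis coeff_pCons_0 degree_eq_zeroE)
  have gen': "on_line ?t G = 0 \<and> 2 < r \<or> line_order ?t r G \<and> poly (fps_nth G (Suc r)) ?t = 0"
    using gen unfolding G_def .
  have below: "poly (fps_nth G k) ?t = 0" if "k < r \<or> k = Suc r" for k
    using gen'
  proof
    assume "on_line ?t G = 0 \<and> 2 < r"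
    then show ?thesis
      by (metis fps_zero_nth on_line_nth)
  next
    assume "line_order ?t r G \<and> poly (fps_nth G (Suc r)) ?t = 0"
    then show ?thesis
      using that unfolding line_order_def by blast
  qed
  \<comment> \<open>from degree three on, a part that vanishes on the line is zero\<close>
  have G_zero: "fps_nth G k = 0" if "3 \<le> k" "k < r \<or> k = Suc r" for k
    using below[OF that(2)] unfolding G_high[OF that(1)] by simp
  \<comment> \<open>\<open>h\<close> collects the terms in \<open>\<rho>\<^sup>2\<close> and \<open>\<rho>\<^sup>r\<close>, which coincide for \<open>r = 2\<close>\<close>
  have v_form: "v = Theta + smul (\<gamma> 1 1) (E 1 1) + smul (\<gamma> 0 1) (E 0 1)
      + smul (\<gamma> 2 2) (E 2 2) + smul (\<gamma> 1 2) (E 1 2) + field_of h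
      + formal_sum (\<lambda>k. smul (\<gamma> 0 k) (E 0 k)) {r + 2..}"
    if h: "\<And>k. fps_nth h k = (if k = 2 \<or> k = r then [:\<gamma> 0 k:] else 0)" for h
    unfolding v
  proof (rule field_of_explicit, rule fps_ext)
    fix n
    consider "n = 0" | "n = 1" | "n = 2" | "3 \<le> n" "n < r \<or> n = Suc r" | "3 \<le> n" "n = r \<or> r + 2 \<le> n"
      by linarith
    then show "fps_nth G n = fps_nth (fps_const [:\<gamma> 1 1:] * monomial 1 1
        + fps_const [:\<gamma> 0 1:] * monomial 0 1 + fps_const [:\<gamma> 2 2:] * monomial 2 2
        + fps_const [:\<gamma> 1 2:] * monomial 1 2 + h
        + Abs_fps (\<lambda>k. if k \<in> {r + 2..} then [:\<gamma> 0 k:] else 0)) n"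
    proof cases
      case 1
      then show ?thesis
        using G r by (simp add: monomial_nth h admissible_def)
    next
      case 2
      then show ?thesis
        using r G1 by (simp add: monomial_nth h \<gamma>_low[unfolded One_nat_def] monom_altdef)
    next
      case 3
      then show ?thesis
        using r G2 by (simp add: monomial_nth h \<gamma>_low[unfolded One_nat_def] monom_altdef power2_eq_square)
    next
      case 4
      then show ?thesis
        using G_zero[of n] by (auto simp: monomial_nth h)
    next
      case 5
      then show ?thesis
        using G_high[of n] by (auto simp: monomial_nth h)
    qed
  qed
  let ?form1 = "v = Theta + smul (\<gamma> 1 1) (E 1 1) + smul (\<gamma> 0 1) (E 0 1)
      + smul (\<gamma> 2 2) (E 2 2) + smul (\<gamma> 1 2) (E 1 2) + smul (\<gamma> 0 r) (E 0 r)
      + formal_sum (\<lambda>k. smul (\<gamma> 0 k) (E 0 k)) {r + 2..}"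
  let ?form2 = "v = Theta + smul (\<gamma> 1 1) (E 1 1) + smul (\<gamma> 0 1) (E 0 1)
      + smul (\<gamma> 2 2) (E 2 2) + smul (\<gamma> 1 2) (E 1 2) + smul (divisible_coeff \<gamma>) (E 0 2)
      + smul (\<gamma> 0 r) (E 0 r) + formal_sum (\<lambda>k. smul (\<gamma> 0 k) (E 0 k)) {r + 2..}"
  have form: "2 \<le> r \<and> ?form1 \<or> 2 < r \<and> divisible_coeff \<gamma> \<noteq> 0 \<and> ?form2"
  proof (cases "r = 2 \<or> \<gamma> 0 2 = 0")
    case True
    have "fps_nth (fps_const [:\<gamma> 0 r:] * monomial 0 r) k =
        (if k = 2 \<or> k = r then [:\<gamma> 0 k:] else 0)" for k
      using True by (auto simp: monomial_nth monom_altdef)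
    from v_form[OF this] have ?form1
      by (simp add: field_of_linear field_of_monomial)
    then show ?thesis
      using r by simp
  next
    case False
    then have r2: "2 < r"
      using r by linarith
    have "poly (fps_nth G 2) ?t = 0"
      by (rule below) (use r2 in simp)
    \<comment> \<open>a quadratic part that vanishes on the line is divisible by the linear one\<close>
    then have d: "divisible_coeff \<gamma> = \<gamma> 0 2"
      using assms(1) unfolding divisible_coeff_def \<gamma>_low G2
      by (simp add: field_simps power2_eq_square)
    have "fps_nth (fps_const [:\<gamma> 0 2:] * monomial 0 2 + fps_const [:\<gamma> 0 r:] * monomial 0 r) k =
        (if k = 2 \<or> k = r then [:\<gamma> 0 k:] else 0)" for k
      using False by (auto simp: monomial_nth monom_altdef)
    from v_form[OF this] have ?form2
      by (simp add: d field_of_linear field_of_monomial add.assoc)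
    then show ?thesis
      using r2 d False by simp
  qed
  have "graded G n = 0" if "1 \<le> k" "k \<le> n" "graded G n \<in> level_im v n k" for n k
    using normal_form_not_removable[OF G G1 assms(1) _ _ that(1,2), of r] pure gen' that(3)
    unfolding v G_def[symmetric] by blast
  then obtain C where C: "infinite_normal_form C v" "\<And>k. 1 \<le> k \<Longrightarrow> level_normal_form C k v"
    using normal_form_style_exists[OF G v] by metis
  have symm: "trivial_symmetry v \<psi>" if "\<gamma> 0 r \<noteq> 0" "\<psi> \<in> symmetry_group v" for \<psi>
  proof -
    have "line_order ?t r G"
    proof (rule ccontr)
      assume "\<not> line_order ?t r G"
      then have "on_line ?t G = 0" "3 \<le> r"
        using gen' by auto
      then have "poly (fps_nth G r) ?t = 0"
        by (metis fps_zero_nth on_line_nth)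
      then show False
        using G_high[OF \<open>3 \<le> r\<close>] that(1) by simp
    qed
    then show ?thesis
      using symmetries_trivial[OF G G1 assms(1)] that(2) unfolding v by blast
  qed
  have perm: "exp_ad (field_of s) \<in> permissible"
    unfolding permissible_def generators_eq using s by blast
  show ?thesis
  proof (rule exI[of _ r], rule exI[of _ "exp_ad (field_of s)"], rule exI[of _ \<gamma>],
      rule exI[of _ v], rule exI[of _ C], intro conjI)
    show "v = exp_ad (field_of s) v2"
      by (rule v_def)
    show "\<gamma> 1 1 \<noteq> 0"
      using assms(1) \<gamma>_low(1) by simp
    show "level_normal_form C (2 * r + 2) v"
      by (rule C(2)) simp
    show "\<gamma> 0 r \<noteq> 0 \<longrightarrow> (\<forall>\<psi>\<in>symmetry_group v. trivial_symmetry v \<psi>)"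
      using symm by blast
  qed (use perm form C(1) in blast)+
qed

end
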